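(* Let $\mathcal{M}$ be a gridding matrix each of whose non-empty entries is a permutation class containing only finitely many simple permutations, such that the graph $G_\mathcal{M}$ is a forest and every connected component of $G_\mathcal{M}$ contains at most one cell labelled by a class that is not monotone (i.e. not $\mathrm{Av}(21)$ or $\mathrm{Av}(12)$). Then $\mathrm{Grid}(\mathcal{M})$ is partially well-ordered.
   Context: A permutation $\pi$ is identified with its plot $\{(i,\pi(i))\}$; $\alpha\le\pi$ if $\pi$ has a subsequence order isomorphic to $\alpha$. A permutation class is a downward closed set under $\le$; $\mathrm{Av}(21)$ and $\mathrm{Av}(12)$ are the classes of increasing and decreasing permutations (the monotone classes). Partially well-ordered means containing no infinite antichain. An interval of $\pi$ is a set of contiguous positions whose values are also contiguous; $\pi$ is simple if its only intervals are trivial (empty, singletons, the whole). Matrices are indexed from the bottom-left with column index first ($\mathcal{M}_{ij}$ is in column $i$, row $j$). A gridding matrix has entries that are permutation classes (infinite or empty). An $\mathcal{M}$-gridding of $\pi$, for an $m\times n$ gridding matrix $\mathcal{M}$, is a choice of $m-1$ vertical and $n-1$ horizontal lines dividing the plot into cells such that the points in cell $ij$ are order isomorphic to a permutation in $\mathcal{M}_{ij}$; $\mathrm{Grid}(\mathcal{M})$ is the class of permutations having an $\mathcal{M}$-gridding. $G_\mathcal{M}$ is the graph on the non-empty cells of $\mathcal{M}$ in which two cells are adjacent if they share a row or column and all cells strictly between them are empty. *)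

theory Defs
  imports "HOL-Library.Sublist" "HOL-Combinatorics.Multiset_Permutations"
    "Graph_Theory.Graph_Theory"
begin

section \<open>Permutations and pattern containment\<close>

text \<open>A permutation \<open>\<pi>\<close> of length \<open>k\<close> is the list \<open>[\<pi>(1), \<dots>, \<pi>(k)]\<close>. Lists are indexed
  from 0, so position \<open>i\<close> of the plot corresponds to list index \<open>i - 1\<close>. The empty permutation is
  included.\<close>

definition perms :: "nat list set" where
  "perms = (\<Union>k. permutations_of_set {1..k})"

definition order_iso :: "nat list \<Rightarrow> nat list \<Rightarrow> bool" where
  "order_iso xs ys \<longleftrightarrow> length xs = length ys \<and>
     (\<forall>i<length xs. \<forall>j<length xs. xs ! i < xs ! j \<longleftrightarrow> ys ! i < ys ! j)"

definition contained_in :: "nat list \<Rightarrow> nat list \<Rightarrow> bool" where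
  "contained_in \<alpha> \<pi> \<longleftrightarrow> (\<exists>xs. subseq xs \<pi> \<and> order_iso xs \<alpha>)"

definition perm_class :: "nat list set \<Rightarrow> bool" where
  "perm_class C \<longleftrightarrow> C \<subseteq> perms \<and> (\<forall>\<pi>\<in>C. \<forall>\<alpha>\<in>perms. contained_in \<alpha> \<pi> \<longrightarrow> \<alpha> \<in> C)"

definition Av :: "nat list \<Rightarrow> nat list set" where
  "Av \<beta> = {\<pi> \<in> perms. \<not> contained_in \<beta> \<pi>}"

definition monotone_class :: "nat list set \<Rightarrow> bool" where
  "monotone_class C \<longleftrightarrow> C = Av [2, 1] \<or> C = Av [1, 2]"

definition antichain :: "nat list set \<Rightarrow> bool" where
  "antichain A \<longleftrightarrow> (\<forall>\<alpha>\<in>A. \<forall>\<beta>\<in>A. \<alpha> \<noteq> \<beta> \<longrightarrow> \<not> contained_in \<alpha> \<beta>)"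

definition partially_well_ordered :: "nat list set \<Rightarrow> bool" where
  "partially_well_ordered C \<longleftrightarrow> \<not> (\<exists>A\<subseteq>C. infinite A \<and> antichain A)"


section \<open>Simple permutations\<close>

definition perm_interval :: "nat list \<Rightarrow> nat set \<Rightarrow> bool" where
  "perm_interval \<pi> I \<longleftrightarrow> I \<subseteq> {..<length \<pi>} \<and>
     (\<exists>a b. I = {a..<b}) \<and> (\<exists>c d. (\<lambda>i. \<pi> ! i) ` I = {c..<d})"

definition simple_perm :: "nat list \<Rightarrow> bool" where
  "simple_perm \<pi> \<longleftrightarrow> \<pi> \<in> perms \<and>
     (\<forall>I. perm_interval \<pi> I \<longrightarrow> I = {} \<or> (\<exists>i. I = {i}) \<or> I = {..<length \<pi>})"


section \<open>Grid classes\<close>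

text \<open>In a matrix \<open>M\<close> with \<open>m\<close> columns and \<open>n\<close> rows, \<open>M i j\<close> is the entry in column \<open>i\<close> (from the
  left) and row \<open>j\<close> (from the bottom), for \<open>1 \<le> i \<le> m\<close> and \<open>1 \<le> j \<le> n\<close>; other values of \<open>M\<close> are
  irrelevant. The empty class is \<open>{}\<close>.\<close>

definition gridding_matrix :: "nat \<Rightarrow> nat \<Rightarrow> (nat \<Rightarrow> nat \<Rightarrow> nat list set) \<Rightarrow> bool" where
  "gridding_matrix m n M \<longleftrightarrow> 1 \<le> m \<and> 1 \<le> n \<and>
     (\<forall>i\<in>{1..m}. \<forall>j\<in>{1..n}. perm_class (M i j) \<and> (M i j = {} \<or> infinite (M i j)))"

definition nonempty_cells :: "nat \<Rightarrow> nat \<Rightarrow> (nat \<Rightarrow> nat \<Rightarrow> nat list set) \<Rightarrow> (nat \<times> nat) set" where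
  "nonempty_cells m n M = {(i, j). i \<in> {1..m} \<and> j \<in> {1..n} \<and> M i j \<noteq> {}}"

text \<open>The \<open>i\<close>-th vertical line is at abscissa \<open>v i + 1/2\<close>, the \<open>j\<close>-th horizontal line at ordinate
  \<open>h j + 1/2\<close>; \<open>v 0\<close>, \<open>v m\<close>, \<open>h 0\<close>, \<open>h n\<close> describe the boundary of the plot. Thus cell \<open>(i, j)\<close>
  contains the points \<open>(p, \<pi>(p))\<close> with \<open>v (i - 1) < p \<le> v i\<close> and \<open>h (j - 1) < \<pi>(p) \<le> h j\<close>,
  listed below from left to right. Lines may coincide.\<close>

definition cell_points ::
    "nat list \<Rightarrow> (nat \<Rightarrow> nat) \<Rightarrow> (nat \<Rightarrow> nat) \<Rightarrow> nat \<Rightarrow> nat \<Rightarrow> nat list" where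
  "cell_points \<pi> v h i j =
     filter (\<lambda>y. h (j - 1) < y \<and> y \<le> h j) (nths \<pi> {v (i - 1)..<v i})"

text \<open>A cell without points is allowed for every entry, in particular for the empty class, which
  does not contain the empty permutation.\<close>

definition is_gridding ::
    "nat \<Rightarrow> nat \<Rightarrow> (nat \<Rightarrow> nat \<Rightarrow> nat list set) \<Rightarrow> nat list \<Rightarrow> (nat \<Rightarrow> nat) \<Rightarrow> (nat \<Rightarrow> nat) \<Rightarrow> bool" where
  "is_gridding m n M \<pi> v h \<longleftrightarrow>
     v 0 = 0 \<and> v m = length \<pi> \<and> mono_on {0..m} v \<and>
     h 0 = 0 \<and> h n = length \<pi> \<and> mono_on {0..n} h \<and>
     (\<forall>i\<in>{1..m}. \<forall>j\<in>{1..n}.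
        cell_points \<pi> v h i j = [] \<or> (\<exists>\<sigma>\<in>M i j. order_iso (cell_points \<pi> v h i j) \<sigma>))"

definition Grid :: "nat \<Rightarrow> nat \<Rightarrow> (nat \<Rightarrow> nat \<Rightarrow> nat list set) \<Rightarrow> nat list set" where
  "Grid m n M = {\<pi> \<in> perms. \<exists>v h. is_gridding m n M \<pi> v h}"


section \<open>The graph of a gridding matrix\<close>

definition cell_adj :: "(nat \<Rightarrow> nat \<Rightarrow> nat list set) \<Rightarrow> nat \<times> nat \<Rightarrow> nat \<times> nat \<Rightarrow> bool" where
  "cell_adj M = (\<lambda>(i, j) (k, l).
     (i = k \<and> j \<noteq> l \<and> (\<forall>t. min j l < t \<and> t < max j l \<longrightarrow> M i t = {})) \<or>
     (j = l \<and> i \<noteq> k \<and> (\<forall>t. min i k < t \<and> t < max i k \<longrightarrow> M t j = {})))"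

text \<open>As usual in this library, an undirected graph is a symmetric digraph.\<close>

definition grid_graph ::
    "nat \<Rightarrow> nat \<Rightarrow> (nat \<Rightarrow> nat \<Rightarrow> nat list set) \<Rightarrow> (nat \<times> nat) pair_pre_digraph" where
  "grid_graph m n M =
     \<lparr> pverts = nonempty_cells m n M,
       parcs = {(c, d). c \<in> nonempty_cells m n M \<and> d \<in> nonempty_cells m n M \<and> cell_adj M c d} \<rparr>"

lemma pair_graph_grid_graph: "pair_graph (grid_graph m n M)"
proof
  have "nonempty_cells m n M \<subseteq> {1..m} \<times> {1..n}"
    by (auto simp: nonempty_cells_def)
  then show fin: "finite (pverts (grid_graph m n M))"
    using finite_subset by (fastforce simp: grid_graph_def)
  have "parcs (grid_graph m n M) \<subseteq> pverts (grid_graph m n M) \<times> pverts (grid_graph m n M)"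
    by (auto simp: grid_graph_def)
  then show "finite (parcs (grid_graph m n M))"
    using fin finite_subset by blast
  show "symmetric (grid_graph m n M)"
    unfolding symmetric_def
    by (auto simp: sym_def grid_graph_def cell_adj_def min.commute max.commute)
qed (auto simp: grid_graph_def cell_adj_def)

text \<open>The library predicate \<^const>\<open>forest\<close> counts a back-and-forth walk along one edge
  as a cycle, so it fails for every symmetric digraph with an arc. The cycles of an undirected simple
  graph are the directed cycles with at least three arcs.\<close>

definition undirected_forest :: "'a pair_pre_digraph \<Rightarrow> bool" where
  "undirected_forest G \<longleftrightarrow> \<not> (\<exists>p. pre_digraph.cycle (with_proj G) p \<and> 3 \<le> length p)"

text \<open>In a symmetric digraph the strongly connected components are the connected components.\<close>

definition components_verts :: "'a pair_pre_digraph \<Rightarrow> 'a set set" where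
  "components_verts G = pre_digraph.sccs_verts (with_proj G)"

end

theory Submission
  imports Defs "HOL-Library.Ramsey" "HOL-Library.Nat_Bijection"
begin

text \<open>Gridded permutations are compared as labelled point sets, with labels from an arbitrary
  well-quasi-order. For a single cell whose class has finitely many simple permutations this gives a
  well-quasi-order, by a minimal bad sequence argument on inflations of simple permutations. The
  cells of a forest can be ordered so that each one either shares no row or column with its
  predecessors, or is monotone and shares only a row or only a column with them: a longest path ends
  in two leaves, one of which is monotone. In the first case the well-quasi-order on the larger set of
  cells is a product. In the second case the points of the new cell fall into the gaps between the
  points of its row (or column), so they can be recorded as words labelling these points, and Higman's
  theorem applies.\<close>

section \<open>Well-quasi-orders\<close>

text \<open>Labels range over all well-quasi-orders because adding a monotone cell spends them: its
  points are stored as words attached to the labels of older points, so the statement for the larger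
  set of cells under one order of labels needs the statement for the smaller set under a richer
  order. Monotonicity makes this possible: a cell alone in its column meets the rest only through
  the heights of its points, and in a monotone cell these heights fix the horizontal order too. In a
  general class they do not, so such a cell has to enter while it shares no line with the cells
  present; this is the reason for allowing one per component. Deleting a cell could make two cells
  adjacent that it used to separate, but a cell with at most one neighbour separates no two, so the
  hypotheses survive. Relative positions of points in different rows or columns are fixed by the
  grid lines, hence embeddings need to respect order only within a line.\<close>

text \<open>The relation is not required to be a quasi-order (it is "almost full").\<close>

definition wqo_on :: "('a \<Rightarrow> 'a \<Rightarrow> bool) \<Rightarrow> 'a set \<Rightarrow> bool" where
  "wqo_on P A \<longleftrightarrow> (\<forall>s::nat \<Rightarrow> 'a. (\<forall>i. s i \<in> A) \<longrightarrow> (\<exists>i j. i < j \<and> P (s i) (s j)))"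

lemma wqo_onI:
  "(\<And>s::nat \<Rightarrow> 'a. (\<And>i. s i \<in> A) \<Longrightarrow> \<exists>i j. i < j \<and> P (s i) (s j)) \<Longrightarrow> wqo_on P A"
  unfolding wqo_on_def by blast

lemma wqo_onD:
  assumes "wqo_on P A" "\<And>i::nat. s i \<in> A"
  obtains i j where "i < j" "P (s i) (s j)"
  using assms unfolding wqo_on_def by blast

lemma wqo_on_subset: "wqo_on P B \<Longrightarrow> A \<subseteq> B \<Longrightarrow> wqo_on P A"
  unfolding wqo_on_def by blast

lemma wqo_on_map:
  assumes "wqo_on Q B" "\<And>a. a \<in> A \<Longrightarrow> f a \<in> B"
    "\<And>a b. a \<in> A \<Longrightarrow> b \<in> A \<Longrightarrow> Q (f a) (f b) \<Longrightarrow> P a b"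
  shows "wqo_on P A"
proof (rule wqo_onI)
  fix s :: "nat \<Rightarrow> 'b" assume s: "\<And>i. s i \<in> A"
  then have "\<And>i. f (s i) \<in> B" using assms(2) by blast
  then obtain i j where "i < j" "Q (f (s i)) (f (s j))"
    using wqo_onD[OF assms(1), of "f \<circ> s"] by auto
  then show "\<exists>i j. i < j \<and> P (s i) (s j)"
    using assms(3) s by blast
qed

text \<open>Colour a pair of indices by whether it is good. The infinite homogeneous set of Ramsey's
  theorem cannot be all bad, since it indexes a sequence in A. As P need not be transitive, a chain
  of consecutive comparisons would not do.\<close>

lemma wqo_on_subsequence:
  fixes s :: "nat \<Rightarrow> 'a"
  assumes "wqo_on P A" "\<And>i. s i \<in> A"
  obtains \<phi> :: "nat \<Rightarrow> nat" where "strict_mono \<phi>" "\<And>i j. i < j \<Longrightarrow> P (s (\<phi> i)) (s (\<phi> j))"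
proof -
  define col where "col e = (if P (s (Min e)) (s (Max e)) then 1 else (0::nat))" for e
  have "\<exists>Y t. Y \<subseteq> (UNIV::nat set) \<and> infinite Y \<and> t < 2 \<and>
      (\<forall>x\<in>Y. \<forall>y\<in>Y. x \<noteq> y \<longrightarrow> col {x, y} = t)"
    by (rule Ramsey2) (auto simp: col_def)
  then obtain Y t where Y: "infinite Y" "\<forall>x\<in>Y. \<forall>y\<in>Y. x \<noteq> y \<longrightarrow> col {x, y} = t"
    by blast
  define \<phi> where "\<phi> = enumerate Y"
  have mono: "strict_mono \<phi>" using Y(1) by (simp add: \<phi>_def strict_mono_enumerate)
  have col: "col {\<phi> i, \<phi> j} = t" if "i < j" for i j
    using Y mono that by (metis \<phi>_def enumerate_in_set less_irrefl strict_monoD)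
  have P: "P (s (\<phi> i)) (s (\<phi> j)) \<longleftrightarrow> t = 1" if "i < j" for i j
    using col[OF that] strict_monoD[OF mono that] by (auto simp: col_def min_def max_def split: if_splits)
  obtain i j where "i < j" "P (s (\<phi> i)) (s (\<phi> j))"
    using wqo_onD[OF assms(1), of "s \<circ> \<phi>"] assms(2) by auto
  with P have "t = 1" by blast
  with P mono that show ?thesis by blast
qed

lemma wqo_on_Times:
  assumes "wqo_on P A" "wqo_on Q B"
  shows "wqo_on (\<lambda>(a, b) (a', b'). P a a' \<and> Q b b') (A \<times> B)"
proof (rule wqo_onI)
  fix s :: "nat \<Rightarrow> 'a \<times> 'b" assume s: "\<And>i. s i \<in> A \<times> B"
  have "fst (s i) \<in> A" for i using s[of i] by auto
  then obtain \<phi> :: "nat \<Rightarrow> nat" where \<phi>: "strict_mono \<phi>"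
    "\<And>i j. i < j \<Longrightarrow> P (fst (s (\<phi> i))) (fst (s (\<phi> j)))"
    using wqo_on_subsequence[OF assms(1), of "fst \<circ> s"] by auto
  have "snd (s (\<phi> i)) \<in> B" for i using s[of "\<phi> i"] by auto
  then obtain i j where "i < j" "Q (snd (s (\<phi> i))) (snd (s (\<phi> j)))"
    using wqo_onD[OF assms(2), of "\<lambda>i. snd (s (\<phi> i))"] by blast
  then show "\<exists>i j. i < j \<and> (\<lambda>(a, b) (a', b'). P a a' \<and> Q b b') (s i) (s j)"
    using \<phi> strict_monoD[OF \<phi>(1)] unfolding split_beta by blast
qed

lemma wqo_on_Un:
  assumes "wqo_on P A" "wqo_on P B"
  shows "wqo_on P (A \<union> B)"
proof (rule wqo_onI)
  fix s :: "nat \<Rightarrow> 'a" assume s: "\<And>i. s i \<in> A \<union> B"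
  have "\<exists>i j. i < j \<and> P (s i) (s j)" if C: "wqo_on P C" "infinite {i. s i \<in> C}" for C
  proof -
    let ?\<phi> = "enumerate {i. s i \<in> C}"
    have "s (?\<phi> i) \<in> C" for i using enumerate_in_set[OF C(2), of i] by simp
    then obtain i j where "i < j" "P (s (?\<phi> i)) (s (?\<phi> j))"
      using wqo_onD[OF C(1), of "\<lambda>i. s (?\<phi> i)"] by blast
    then show ?thesis using strict_mono_enumerate[OF C(2)] strict_monoD by blast
  qed
  moreover have "infinite {i. s i \<in> A} \<or> infinite {i. s i \<in> B}"
  proof -
    have "{i. s i \<in> A} \<union> {i. s i \<in> B} = UNIV" using s by blast
    then show ?thesis by (metis finite_UnI infinite_UNIV_nat)
  qed
  ultimately show "\<exists>i j. i < j \<and> P (s i) (s j)" using assms by blast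
qed

lemma wqo_on_empty: "wqo_on P {}"
  by (auto simp: wqo_on_def)

lemma wqo_on_UN:
  "finite I \<Longrightarrow> (\<And>i. i \<in> I \<Longrightarrow> wqo_on P (A i)) \<Longrightarrow> wqo_on P (\<Union>i\<in>I. A i)"
  by (induction rule: finite_induct) (auto intro: wqo_on_Un wqo_on_empty)

lemma wqo_on_le_nat: "wqo_on (\<le>) (UNIV :: nat set)"
proof (rule wqo_onI)
  fix s :: "nat \<Rightarrow> nat"
  obtain i where "\<And>j. s i \<le> s j"
    using ex_has_least_nat[of "\<lambda>_. True" 0 s] by auto
  then show "\<exists>i j. i < j \<and> s i \<le> s j" by (intro exI[of _ i] exI[of _ "Suc i"]) simp
qed

text \<open>Nash-Williams' minimal bad sequence argument. Here \<open>sub x\<close> is a set of parts of \<open>x\<close>.\<close>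

lemma wqo_on_minimal_bad:
  fixes size :: "'a \<Rightarrow> nat"
  assumes sub: "\<And>x y. x \<in> A \<Longrightarrow> y \<in> sub x \<Longrightarrow> y \<in> A \<and> size y < size x"
    and below: "\<And>x y z. x \<in> A \<Longrightarrow> z \<in> A \<Longrightarrow> y \<in> sub z \<Longrightarrow> P x y \<Longrightarrow> P x z"
    and step: "\<And>B. B \<subseteq> A \<Longrightarrow> wqo_on P B \<Longrightarrow> wqo_on P {x \<in> A. sub x \<subseteq> B}"
  shows "wqo_on P A"
proof (rule ccontr)
  assume not_wqo: "\<not> wqo_on P A"
  define bad where "bad s \<longleftrightarrow> (\<forall>i. s i \<in> A) \<and> (\<forall>i j. i < j \<longrightarrow> \<not> P (s i) (s j))" for s :: "nat \<Rightarrow> 'a"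
  obtain s0 where s0: "bad s0" using not_wqo unfolding wqo_on_def bad_def by blast
  define ext where "ext xs s \<longleftrightarrow> bad s \<and> (\<forall>i<length xs. s i = xs ! i)" for xs :: "'a list" and s
  \<comment> \<open>A smallest possible next entry, among those after which the prefix can still be
    prolonged to an infinite bad sequence.\<close>
  define nxt where "nxt xs = (SOME x. (\<exists>s. ext (xs @ [x]) s) \<and>
    (\<forall>y. (\<exists>s. ext (xs @ [y]) s) \<longrightarrow> size x \<le> size y))" for xs
  have nxt: "(\<exists>s. ext (xs @ [nxt xs]) s) \<and>
    (\<forall>y. (\<exists>s. ext (xs @ [y]) s) \<longrightarrow> size (nxt xs) \<le> size y)" if xs: "\<exists>s. ext xs s" for xs
    unfolding nxt_def
  proof (rule someI_ex)
    obtain s where "ext xs s" using xs by blast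
    then have "ext (xs @ [s (length xs)]) s"
      by (auto simp: ext_def nth_append less_Suc_eq)
    then show "\<exists>x. (\<exists>s. ext (xs @ [x]) s) \<and> (\<forall>y. (\<exists>s. ext (xs @ [y]) s) \<longrightarrow> size x \<le> size y)"
      using ex_has_least_nat[of "\<lambda>x. \<exists>s. ext (xs @ [x]) s" _ size] by blast
  qed
  define pre where "pre = rec_nat [] (\<lambda>_ xs. xs @ [nxt xs])"
  have pre_simps: "pre 0 = []" "\<And>k. pre (Suc k) = pre k @ [nxt (pre k)]"
    by (simp_all add: pre_def)
  define m where "m k = nxt (pre k)" for k
  have pre_eq: "pre k = map m [0..<k]" for k
    by (induction k) (auto simp: pre_simps m_def)
  have ext_pre: "\<exists>s. ext (pre k) s" for k
  proof (induction k)
    case 0 then show ?case using s0 by (auto simp: pre_simps ext_def)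
  next
    case (Suc k) then show ?case using nxt[of "pre k"] by (simp add: pre_simps)
  qed
  have m_bad: "bad m"
  proof -
    have "m i \<in> A \<and> (\<forall>j>i. \<not> P (m i) (m j))" for i
    proof -
      have "m i \<in> A \<and> (j > i \<longrightarrow> \<not> P (m i) (m j))" for j
      proof -
        obtain s where "ext (pre (Suc (max i j))) s" using ext_pre by blast
        then have s: "bad s" "\<And>k. k < Suc (max i j) \<Longrightarrow> s k = m k"
          by (auto simp: ext_def pre_eq simp del: upt_Suc)
        have "s i = m i" "s j = m j" using s(2) by auto
        then show ?thesis using s(1) by (metis bad_def)
      qed
      then show ?thesis by blast
    qed
    then show ?thesis by (auto simp: bad_def)
  qed
  have m_min: "size (m k) \<le> size (t k)" if t: "bad t" "\<And>i. i < k \<Longrightarrow> t i = m i" for t k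
  proof -
    have "ext (pre k @ [t k]) t"
      using t by (auto simp: ext_def pre_eq nth_append less_Suc_eq)
    then show ?thesis using nxt[OF ext_pre[of k]] by (auto simp: m_def)
  qed
  \<comment> \<open>The parts of all entries of the minimal bad sequence. Once B is
    well-quasi-ordered, \<open>step\<close> makes the entries themselves well-quasi-ordered,
    contradicting badness of \<open>m\<close>.\<close>
  define B where "B = (\<Union>i. sub (m i))"
  have mA: "m i \<in> A" for i using m_bad by (simp add: bad_def)
  have "wqo_on P B"
  proof (rule ccontr)
    assume "\<not> wqo_on P B"
    then obtain b :: "nat \<Rightarrow> 'a" where b: "\<And>i. b i \<in> B" "\<And>i j. i < j \<Longrightarrow> \<not> P (b i) (b j)"
      unfolding wqo_on_def by blast
    have "\<forall>i. \<exists>k. b i \<in> sub (m k)" using b(1) by (auto simp: B_def)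
    then obtain g where g: "\<And>i. b i \<in> sub (m (g i))" by metis
    \<comment> \<open>Starting at a part whose owner comes earliest, the bad sequence of parts can
      be spliced onto \<open>m\<close> at index \<open>g k\<close>. The result is bad and has a
      smaller entry there than \<open>m\<close>.\<close>
    obtain k where k: "\<And>j. g k \<le> g j"
      using ex_has_least_nat[of "\<lambda>_. True" 0 g] by auto
    define t where "t i = (if i < g k then m i else b (k + (i - g k)))" for i
    have bA: "b i \<in> A" for i using sub[OF mA g] by blast
    have "bad t"
      unfolding bad_def
    proof (intro conjI allI impI)
      show "t i \<in> A" for i using mA bA by (simp add: t_def)
      fix i j :: nat assume "i < j"
      consider "j < g k" | "i < g k" "g k \<le> j" | "g k \<le> i" using \<open>i < j\<close> by linarith
      then show "\<not> P (t i) (t j)"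
      proof cases
        case 1 then show ?thesis using \<open>i < j\<close> m_bad by (simp add: t_def bad_def)
      next
        case 2
        let ?l = "k + (j - g k)"
        \<comment> \<open>If \<open>m i\<close> were below the part \<open>b ?l\<close>, then by
          \<open>below\<close> it would be below \<open>m (g ?l)\<close>, a later entry of
          \<open>m\<close>.\<close>
        have "i < g ?l" using 2 k[of ?l] by linarith
        then have "\<not> P (m i) (m (g ?l))" using m_bad by (simp add: bad_def)
        then show ?thesis using below[OF mA mA g] 2 by (auto simp: t_def)
      next
        case 3 then show ?thesis using \<open>i < j\<close> b(2) by (simp add: t_def)
      qed
    qed
    then have "size (m (g k)) \<le> size (b k)"
      using m_min[of t "g k"] by (simp add: t_def)
    then show False using sub[OF mA g, of k] by simp
  qed
  moreover have "B \<subseteq> A" using sub mA by (auto simp: B_def)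
  ultimately have "wqo_on P {x \<in> A. sub x \<subseteq> B}" by (rule step[rotated])
  moreover have "m i \<in> {x \<in> A. sub x \<subseteq> B}" for i using mA by (auto simp: B_def)
  ultimately obtain i j where "i < j" "P (m i) (m j)" by (rule wqo_onD)
  then show False using m_bad by (simp add: bad_def)
qed

text \<open>With the tail as its only part, a nonempty list whose parts lie in B is a pair of a head
  in A and a tail in B, so \<open>step\<close> reduces to a product.\<close>

theorem Higman:
  assumes "wqo_on P A"
  shows "wqo_on (list_emb P) (lists A)"
proof (rule wqo_on_minimal_bad[where sub = "\<lambda>xs. case xs of [] \<Rightarrow> {} | y # ys \<Rightarrow> {ys}" and size = length])
  fix B assume B: "B \<subseteq> lists A" "wqo_on (list_emb P) B"
  let ?sub = "\<lambda>xs. case xs of [] \<Rightarrow> {} | y # ys \<Rightarrow> {ys}"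
  have "wqo_on (list_emb P) {[]}" by (auto simp: wqo_on_def)
  moreover have "wqo_on (list_emb P) ((\<lambda>(y, ys). y # ys) ` (A \<times> B))"
    by (rule wqo_on_map[OF wqo_on_Times[OF assms B(2)], where f = "\<lambda>xs. (hd xs, tl xs)"]) auto
  ultimately have "wqo_on (list_emb P) ({[]} \<union> (\<lambda>(y, ys). y # ys) ` (A \<times> B))"
    by (rule wqo_on_Un)
  then show "wqo_on (list_emb P) {xs \<in> lists A. ?sub xs \<subseteq> B}"
    by (rule wqo_on_subset) (force split: list.splits)
qed (auto split: list.splits)

lemma list_emb_iff_nth:
  "list_emb P xs ys \<longleftrightarrow> (\<exists>g. (\<forall>a<length xs. g a < length ys \<and> P (xs ! a) (ys ! g a)) \<and>
     (\<forall>a<length xs. \<forall>b<length xs. a < b \<longrightarrow> g a < g b))" (is "_ = ?R xs ys")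
proof
  assume "list_emb P xs ys"
  then show "?R xs ys"
  proof induction
    case (list_emb_Nil ys) then show ?case by simp
  next
    case (list_emb_Cons xs ys y)
    then obtain g where "\<forall>a<length xs. g a < length ys \<and> P (xs ! a) (ys ! g a)"
      "\<forall>a<length xs. \<forall>b<length xs. a < b \<longrightarrow> g a < g b" by blast
    then show ?case by (intro exI[of _ "\<lambda>a. Suc (g a)"]) simp
  next
    case (list_emb_Cons2 x y xs ys)
    then obtain g where "\<forall>a<length xs. g a < length ys \<and> P (xs ! a) (ys ! g a)"
      "\<forall>a<length xs. \<forall>b<length xs. a < b \<longrightarrow> g a < g b" by blast
    with list_emb_Cons2 show ?case
      by (intro exI[of _ "\<lambda>a. case a of 0 \<Rightarrow> 0 | Suc a \<Rightarrow> Suc (g a)"]) (auto split: nat.splits)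
  qed
next
  assume "?R xs ys"
  then show "list_emb P xs ys"
  proof (induction ys arbitrary: xs)
    case Nil then show ?case by (cases xs) auto
  next
    case (Cons y ys)
    show ?case
    proof (cases xs)
      case Nil then show ?thesis by simp
    next
      case (Cons x xs')
      obtain g where g: "\<And>a. a < length xs \<Longrightarrow> g a < Suc (length ys) \<and> P (xs ! a) ((y # ys) ! g a)"
        "\<And>a b. a < length xs \<Longrightarrow> b < length xs \<Longrightarrow> a < b \<Longrightarrow> g a < g b"
        using Cons.prems by (metis length_Cons)
      have pos: "g (Suc a) \<noteq> 0" if "Suc a < length xs" for a
        using g(2)[of 0 "Suc a"] that by fastforce
      have tl: "?R xs' ys"
      proof (intro exI[of _ "\<lambda>a. g (Suc a) - 1"] conjI allI impI)
        fix a assume a: "a < length xs'"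
        then show "g (Suc a) - 1 < length ys" using g(1)[of "Suc a"] pos[of a] Cons by auto
        show "P (xs' ! a) (ys ! (g (Suc a) - 1))"
          using a g(1)[of "Suc a"] pos[of a] Cons by (cases "g (Suc a)") auto
        fix b assume "b < length xs'" "a < b"
        then show "g (Suc a) - 1 < g (Suc b) - 1"
          using g(2)[of "Suc a" "Suc b"] pos[of a] pos[of b] a Cons
          by (cases "g (Suc a)"; cases "g (Suc b)") auto
      qed
      show ?thesis
      proof (cases "g 0")
        case 0
        then have "P x y" using g(1)[of 0] Cons by simp
        then show ?thesis using Cons.IH[OF tl] Cons by auto
      next
        case (Suc c)
        have pos: "g a \<noteq> 0" if "a < length xs" for a
          using g(2)[of 0 a] that Suc by (cases a) fastforce+
        have "?R xs ys"
        proof (intro exI[of _ "\<lambda>a. g a - 1"] conjI allI impI)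
          fix a assume a: "a < length xs"
          then show "g a - 1 < length ys" using g(1)[of a] pos[of a] by auto
          show "P (xs ! a) (ys ! (g a - 1))"
            using a g(1)[of a] pos[of a] by (cases "g a") auto
          fix b assume "b < length xs" "a < b"
          then show "g a - 1 < g b - 1"
            using g(2)[of a b] pos[of a] pos[of b] a by (cases "g a"; cases "g b") auto
        qed
        then show ?thesis using Cons.IH by blast
      qed
    qed
  qed
qed

section \<open>Inflations of simple permutations\<close>

text \<open>An increasing index map between lists of equal length is the identity. This turns Higman
  embeddings of lists of blocks into comparisons block by block.\<close>

lemma list_emb_same_length:
  "list_emb P xs ys \<Longrightarrow> length xs = length ys \<Longrightarrow> a < length xs \<Longrightarrow> P (xs ! a) (ys ! a)"
proof (induction arbitrary: a rule: list_emb.induct)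
  case (list_emb_Cons xs ys y)
  then show ?case using list_emb_length[of P xs ys] by simp
next
  case (list_emb_Cons2 x y xs ys)
  then show ?case by (cases a) auto
qed simp

section \<open>Patterns of finite point sets\<close>

lemma perms_iff: "xs \<in> perms \<longleftrightarrow> distinct xs \<and> (\<exists>k. set xs = {1..k})"
  by (auto simp: perms_def permutations_of_set_def)

lemma contained_inI:
  assumes "\<And>a. a < length \<alpha> \<Longrightarrow> f a < length \<pi>"
    "\<And>a b. a < length \<alpha> \<Longrightarrow> b < length \<alpha> \<Longrightarrow> a < b \<Longrightarrow> f a < f b"
    "\<And>a b. a < length \<alpha> \<Longrightarrow> b < length \<alpha> \<Longrightarrow> \<pi> ! f a < \<pi> ! f b \<longleftrightarrow> \<alpha> ! a < \<alpha> ! b"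
  shows "contained_in \<alpha> \<pi>"
  unfolding contained_in_def
proof (intro exI conjI)
  let ?xs = "map (\<lambda>a. \<pi> ! f a) [0..<length \<alpha>]"
  show "subseq ?xs \<pi>" unfolding list_emb_iff_nth
    using assms(1,2) by (intro exI[of _ f]) auto
  show "order_iso ?xs \<alpha>" using assms(3) by (simp add: order_iso_def)
qed

text \<open>Points are natural numbers; \<open>x\<close> and \<open>y\<close> give their coordinates.\<close>

definition has_pattern :: "nat set \<Rightarrow> (nat \<Rightarrow> nat) \<Rightarrow> (nat \<Rightarrow> nat) \<Rightarrow> nat list \<Rightarrow> bool" where
  "has_pattern P x y \<sigma> \<longleftrightarrow> (\<exists>g. bij_betw g {..<length \<sigma>} P \<and>
     (\<forall>a<length \<sigma>. \<forall>b<length \<sigma>. (x (g a) < x (g b) \<longleftrightarrow> a < b) \<and> (y (g a) < y (g b) \<longleftrightarrow> \<sigma> ! a < \<sigma> ! b)))"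

definition pattern_in :: "nat list set \<Rightarrow> nat set \<Rightarrow> (nat \<Rightarrow> nat) \<Rightarrow> (nat \<Rightarrow> nat) \<Rightarrow> bool" where
  "pattern_in C P x y \<longleftrightarrow> (\<exists>\<sigma>\<in>C. has_pattern P x y \<sigma>)"

text \<open>Read the points from left to right and write down the rank of each height. Counting the
  point itself makes the ranks run from 1 to \<open>card P\<close>, as \<open>perms\<close>
  demands.\<close>

lemma ex_pattern:
  assumes "finite P" "inj_on x P" "inj_on y P"
  shows "\<exists>\<sigma>\<in>perms. has_pattern P x y \<sigma>"
proof -
  define xs where "xs = sorted_list_of_set (x ` P)"
  define g where "g a = inv_into P x (xs ! a)" for a
  define rank where "rank p = card {q \<in> P. y q \<le> y p}" for p
  define \<sigma> where "\<sigma> = map (\<lambda>a. rank (g a)) [0..<card P]"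
  have len: "length xs = card P" using assms by (simp add: xs_def card_image)
  have xs: "set xs = x ` P" "strict_sorted xs" using assms by (simp_all add: xs_def)
  have xg: "x (g a) = xs ! a" "g a \<in> P" if "a < card P" for a
    using that xs(1) len nth_mem[of a xs] by (auto simp: g_def f_inv_into_f inv_into_into)
  have x_less: "x (g a) < x (g b) \<longleftrightarrow> a < b" if "a < card P" "b < card P" for a b
  proof -
    have "xs ! a < xs ! b" if "a < b" "b < card P" for a b
      using sorted_wrt_nth_less[OF xs(2)] that len by simp
    then show ?thesis using that xg(1) by (metis linorder_neqE_nat order_less_asym)
  qed
  have "inj_on g {..<card P}"
    using x_less by (intro inj_onI) (metis lessThan_iff less_irrefl linorder_neqE_nat)
  moreover from this have "g ` {..<card P} = P"
    using xg(2) assms(1) by (intro card_subset_eq) (auto simp: card_image)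
  ultimately have bij: "bij_betw g {..<card P} P" by (simp add: bij_betw_def)
  have rank_less: "rank p < rank q" if "p \<in> P" "q \<in> P" "y p < y q" for p q
    unfolding rank_def
  proof (rule psubset_card_mono)
    have "q \<notin> {q \<in> P. y q \<le> y p}" "q \<in> {qa \<in> P. y qa \<le> y q}" using that by auto
    then show "{q \<in> P. y q \<le> y p} \<subset> {qa \<in> P. y qa \<le> y q}" using that(3) by fastforce
  qed (use assms(1) in simp)
  have rank_iff: "rank p < rank q \<longleftrightarrow> y p < y q" if pq: "p \<in> P" "q \<in> P" for p q
  proof -
    consider "y p < y q" | "p = q" | "y q < y p"
      using assms(3) pq by (meson inj_onD linorder_neqE_nat)
    then show ?thesis
      using rank_less[OF pq] rank_less[OF pq(2,1)] by cases auto
  qed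
  have inj_rank: "inj_on rank P"
    using rank_iff assms(3) by (intro inj_onI) (metis inj_onD less_irrefl linorder_neqE_nat)
  have "rank p \<in> {1..card P}" if "p \<in> P" for p
  proof -
    have "{q \<in> P. y q \<le> y p} \<noteq> {}" using that by auto
    then have "rank p > 0" using assms(1) by (simp add: rank_def card_gt_0_iff)
    moreover have "rank p \<le> card P" using assms(1) by (simp add: rank_def card_mono)
    ultimately show ?thesis by simp
  qed
  then have "rank ` P \<subseteq> {1..card P}" by blast
  then have rank_img: "rank ` P = {1..card P}"
    using card_subset_eq[of "{1..card P}" "rank ` P"] card_image[OF inj_rank] by simp
  have "set \<sigma> = {1..card P}"
    using bij rank_img by (simp add: \<sigma>_def bij_betw_def atLeast0LessThan flip: image_image)
  moreover have "distinct \<sigma>"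
    using comp_inj_on[of g "{..<card P}" rank] bij inj_rank
    by (auto simp: \<sigma>_def distinct_map bij_betw_def comp_def lessThan_atLeast0)
  ultimately have "\<sigma> \<in> perms" by (auto simp: perms_iff)
  moreover have "has_pattern P x y \<sigma>"
    unfolding has_pattern_def
    using bij x_less rank_iff xg(2) by (intro exI[of _ g]) (auto simp: \<sigma>_def)
  ultimately show ?thesis by blast
qed

text \<open>Sending a point to its position in the larger set embeds the pattern of the smaller set,
  and C is closed under containment.\<close>

lemma pattern_in_subset:
  assumes C: "perm_class C" and P: "pattern_in C P x y" "finite P" "inj_on x P" "inj_on y P"
    and sub: "P' \<subseteq> P"
  shows "pattern_in C P' x y"
proof -
  obtain \<sigma> g where \<sigma>: "\<sigma> \<in> C" and g: "bij_betw g {..<length \<sigma>} P"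
    "\<And>a b. a < length \<sigma> \<Longrightarrow> b < length \<sigma> \<Longrightarrow> x (g a) < x (g b) \<longleftrightarrow> a < b"
    "\<And>a b. a < length \<sigma> \<Longrightarrow> b < length \<sigma> \<Longrightarrow> y (g a) < y (g b) \<longleftrightarrow> \<sigma> ! a < \<sigma> ! b"
    using P(1) unfolding pattern_in_def has_pattern_def by blast
  obtain \<tau> where \<tau>: "\<tau> \<in> perms" "has_pattern P' x y \<tau>"
    using ex_pattern[of P' x y] P sub by (meson finite_subset inj_on_subset)
  then obtain h where h: "bij_betw h {..<length \<tau>} P'"
    "\<And>a b. a < length \<tau> \<Longrightarrow> b < length \<tau> \<Longrightarrow> x (h a) < x (h b) \<longleftrightarrow> a < b"
    "\<And>a b. a < length \<tau> \<Longrightarrow> b < length \<tau> \<Longrightarrow> y (h a) < y (h b) \<longleftrightarrow> \<tau> ! a < \<tau> ! b"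
    unfolding has_pattern_def by blast
  define f where "f a = inv_into {..<length \<sigma>} g (h a)" for a
  have f: "f a < length \<sigma>" "g (f a) = h a" if "a < length \<tau>" for a
  proof -
    have "h a \<in> g ` {..<length \<sigma>}" using that h(1) g(1) sub by (auto simp: bij_betw_def)
    from inv_into_into[OF this] f_inv_into_f[OF this]
    show "f a < length \<sigma>" "g (f a) = h a" by (simp_all add: f_def)
  qed
  have "contained_in \<tau> \<sigma>"
  proof (rule contained_inI[of _ f])
    show "f a < f b" if "a < length \<tau>" "b < length \<tau>" "a < b" for a b
      using that f g(2)[of "f a" "f b"] h(2)[of a b] by simp
    show "\<sigma> ! f a < \<sigma> ! f b \<longleftrightarrow> \<tau> ! a < \<tau> ! b" if "a < length \<tau>" "b < length \<tau>" for a b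
      using that f g(3)[of "f a" "f b"] h(3)[of a b] by simp
  qed (use f in auto)
  then have "\<tau> \<in> C" using C \<sigma> \<tau>(1) by (auto simp: perm_class_def)
  then show ?thesis using \<tau>(2) by (auto simp: pattern_in_def)
qed

text \<open>The inflation of the substitution decomposition: \<open>t p\<close> is the position of
  the entry of \<sigma> whose block contains p. Surjectivity of \<open>t\<close> makes all blocks
  nonempty, and they are intervals because points of other blocks cannot tell their members
  apart.\<close>

definition inflation ::
    "nat set \<Rightarrow> (nat \<Rightarrow> nat) \<Rightarrow> (nat \<Rightarrow> nat) \<Rightarrow> nat list \<Rightarrow> (nat \<Rightarrow> nat) \<Rightarrow> bool" where
  "inflation P x y \<sigma> t \<longleftrightarrow> t ` P = {..<length \<sigma>} \<and>
     (\<forall>p\<in>P. \<forall>q\<in>P. t p \<noteq> t q \<longrightarrow> (x p < x q \<longleftrightarrow> t p < t q) \<and> (y p < y q \<longleftrightarrow> \<sigma> ! t p < \<sigma> ! t q))"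

text \<open>Among the divisions of P into at least two interval blocks, one with the fewest blocks
  is taken. The pattern of the representatives is simple because a nontrivial interval of it could
  be merged into a single block.\<close>

lemma ex_simple_inflation:
  assumes C: "perm_class C" and P: "pattern_in C P x y" "finite P" "inj_on x P" "inj_on y P"
    and card: "2 \<le> card P"
  shows "\<exists>\<sigma> t. \<sigma> \<in> C \<and> simple_perm \<sigma> \<and> 2 \<le> length \<sigma> \<and> inflation P x y \<sigma> t"
proof -
  \<comment> \<open>\<open>r\<close> sends each point to a representative of its block, the blocks being intervals.\<close>
  define retr where "retr r \<longleftrightarrow> r ` P \<subseteq> P \<and> 2 \<le> card (r ` P) \<and>
    (\<forall>p\<in>P. \<forall>q\<in>P. r p \<noteq> r q \<longrightarrow> (x p < x q \<longleftrightarrow> x (r p) < x (r q)) \<and> (y p < y q \<longleftrightarrow> y (r p) < y (r q)))"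
    for r :: "nat \<Rightarrow> nat"
  have "retr (\<lambda>p. p)" using card by (simp add: retr_def)
  then obtain r where r: "retr r" and r_min: "\<And>r'. retr r' \<Longrightarrow> card (r ` P) \<le> card (r' ` P)"
    using ex_has_least_nat[of retr "\<lambda>p. p" "\<lambda>r. card (r ` P)"] by blast
  have rP: "r ` P \<subseteq> P" "2 \<le> card (r ` P)" using r by (simp_all add: retr_def)
  have rord: "x p < x q \<longleftrightarrow> x (r p) < x (r q)" "y p < y q \<longleftrightarrow> y (r p) < y (r q)"
    if "p \<in> P" "q \<in> P" "r p \<noteq> r q" for p q
    using r that by (simp_all add: retr_def)
  have "pattern_in C (r ` P) x y" using pattern_in_subset[OF C P rP(1)] .
  then obtain \<sigma> g where \<sigma>: "\<sigma> \<in> C" and g: "bij_betw g {..<length \<sigma>} (r ` P)"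
    "\<And>a b. a < length \<sigma> \<Longrightarrow> b < length \<sigma> \<Longrightarrow> x (g a) < x (g b) \<longleftrightarrow> a < b"
    "\<And>a b. a < length \<sigma> \<Longrightarrow> b < length \<sigma> \<Longrightarrow> y (g a) < y (g b) \<longleftrightarrow> \<sigma> ! a < \<sigma> ! b"
    unfolding pattern_in_def has_pattern_def by blast
  have len: "length \<sigma> = card (r ` P)" using bij_betw_same_card[OF g(1)] by simp
  have perm: "\<sigma> \<in> perms" using C \<sigma> by (auto simp: perm_class_def)
  then have dist: "distinct \<sigma>" by (simp add: perms_iff)
  have simple: "simple_perm \<sigma>"
    unfolding simple_perm_def
  proof (intro conjI allI impI perm)
    fix I assume I: "perm_interval \<sigma> I"
    show "I = {} \<or> (\<exists>i. I = {i}) \<or> I = {..<length \<sigma>}"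
    proof (rule ccontr)
      assume nontriv: "\<not> ?thesis"
      obtain a b c d where ab: "I = {a..<b}" and cd: "(\<lambda>i. \<sigma> ! i) ` I = {c..<d}"
        and I_sub: "I \<subseteq> {..<length \<sigma>}"
        using I by (auto simp: perm_interval_def)
      obtain i0 where i0: "i0 \<in> I" using nontriv by blast
      obtain i1 where i1: "i1 \<in> I" "i1 \<noteq> i0" using nontriv i0 by blast
      \<comment> \<open>\<open>e\<close>, outside the interval, keeps at least two blocks after
        merging; \<open>i1\<close>, inside it, makes the number of blocks drop.\<close>
      obtain e where e: "e < length \<sigma>" "e \<notin> I" using nontriv I_sub by blast
      define J where "J = g ` I"
      have inj_g: "inj_on g {..<length \<sigma>}" and g_img: "g ` {..<length \<sigma>} = r ` P"
        using g(1) by (simp_all add: bij_betw_def)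
      have J_sub: "J \<subseteq> r ` P" using I_sub g_img by (auto simp: J_def)
      \<comment> \<open>A point outside the interval lies on the same side of all its members,
        horizontally since their positions are contiguous and vertically since their values
        are.\<close>
      have side: "(x u < x p \<longleftrightarrow> x v < x p) \<and> (x p < x u \<longleftrightarrow> x p < x v) \<and>
          (y u < y p \<longleftrightarrow> y v < y p) \<and> (y p < y u \<longleftrightarrow> y p < y v)"
        if "p \<in> r ` P" "p \<notin> J" "u \<in> J" "v \<in> J" for p u v
      proof -
        have "p \<in> g ` {..<length \<sigma>}" using \<open>p \<in> r ` P\<close> g_img by simp
        then obtain k where k: "k < length \<sigma>" "p = g k" by blast
        obtain i j where "i \<in> I" "u = g i" "j \<in> I" "v = g j"
          using \<open>u \<in> J\<close> \<open>v \<in> J\<close> by (auto simp: J_def)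
        note kij = k this
        have "k \<notin> I" using kij that(2) by (auto simp: J_def)
        have ij: "i < length \<sigma>" "j < length \<sigma>" using kij I_sub by auto
        have "i < k \<longleftrightarrow> j < k" "k < i \<longleftrightarrow> k < j" using \<open>k \<notin> I\<close> kij ab by auto
        moreover have "\<sigma> ! i \<in> {c..<d}" "\<sigma> ! j \<in> {c..<d}" using kij cd by blast+
        moreover have "\<sigma> ! k \<notin> {c..<d}"
        proof
          assume "\<sigma> ! k \<in> {c..<d}"
          then obtain l where "l \<in> I" "\<sigma> ! k = \<sigma> ! l" using cd by (metis imageE)
          then show False using \<open>k \<notin> I\<close> dist I_sub kij(1) nth_eq_iff_index_eq by blast
        qed
        ultimately show ?thesis using g(2,3) kij ij by auto
      qed
      define j0 where "j0 = g i0"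
      have j0: "j0 \<in> J" using i0 by (simp add: j0_def J_def)
      define r' where "r' p = (if r p \<in> J then j0 else r p)" for p
      have img: "r' ` P = insert j0 (r ` P - J)"
        using j0 J_sub by (auto simp: r'_def image_iff) 
      have ge: "g e \<in> r ` P" "g e \<notin> J"
        using e g_img inj_g I_sub by (auto simp: J_def inj_on_def)
      have fin: "finite (r ` P)" using P by simp
      have "retr r'"
        unfolding retr_def
      proof (intro conjI ballI impI)
        show "r' ` P \<subseteq> P" using img j0 J_sub rP by auto
        have "card {j0, g e} \<le> card (r' ` P)"
          using img ge fin by (intro card_mono) auto
        then show "2 \<le> card (r' ` P)" using ge(2) j0 by (auto simp: card_insert_if split: if_splits)
        fix p q assume pq: "p \<in> P" "q \<in> P" "r' p \<noteq> r' q"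
        then have "r p \<noteq> r q" unfolding r'_def by metis
        then have "(x p < x q \<longleftrightarrow> x (r p) < x (r q)) \<and> (y p < y q \<longleftrightarrow> y (r p) < y (r q))"
          using rord pq by blast
        moreover have "(x (r p) < x (r q) \<longleftrightarrow> x (r' p) < x (r' q)) \<and>
          (y (r p) < y (r q) \<longleftrightarrow> y (r' p) < y (r' q))"
        proof (cases "r p \<in> J")
          case True
          then have "r q \<notin> J" using pq by (auto simp: r'_def)
          then show ?thesis using True side[of "r q" "r p" j0] j0 pq by (auto simp: r'_def)
        next
          case False
          then show ?thesis using side[of "r p" "r q" j0] j0 pq by (auto simp: r'_def)
        qed
        ultimately show "x p < x q \<longleftrightarrow> x (r' p) < x (r' q)" "y p < y q \<longleftrightarrow> y (r' p) < y (r' q)"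
          by auto
      qed
      moreover have "card (r' ` P) < card (r ` P)"
      proof (rule psubset_card_mono[OF fin])
        have "g i1 \<in> J" "g i1 \<noteq> j0"
          using i0 i1 inj_g I_sub by (auto simp: J_def j0_def inj_on_def)
        then show "r' ` P \<subset> r ` P" unfolding img using j0 J_sub by blast
      qed
      ultimately show False using r_min by fastforce
    qed
  qed
  define t where "t p = inv_into {..<length \<sigma>} g (r p)" for p
  have t: "t p < length \<sigma>" "g (t p) = r p" if "p \<in> P" for p
  proof -
    have "r p \<in> g ` {..<length \<sigma>}" using that g(1) by (auto simp: bij_betw_def)
    from inv_into_into[OF this] f_inv_into_f[OF this]
    show "t p < length \<sigma>" "g (t p) = r p" by (simp_all add: t_def)
  qed
  have "inflation P x y \<sigma> t"
    unfolding inflation_def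
  proof (intro conjI ballI impI equalityI subsetI)
    fix a assume a: "a \<in> {..<length \<sigma>}"
    then obtain p where p: "p \<in> P" "g a = r p" using g(1) by (auto simp: bij_betw_def)
    then have "t p = a" using a g(1) by (simp add: t_def bij_betw_def flip: p(2))
    then show "a \<in> t ` P" using p by blast
  next
    fix p q assume pq: "p \<in> P" "q \<in> P" "t p \<noteq> t q"
    then have "r p \<noteq> r q" by (auto simp: t_def)
    then show "x p < x q \<longleftrightarrow> t p < t q" "y p < y q \<longleftrightarrow> \<sigma> ! t p < \<sigma> ! t q"
      using rord[OF pq(1,2)] g(2,3)[of "t p" "t q"] t pq by simp_all
  qed (use t in auto)
  then show ?thesis using \<sigma> simple len rP(2) by auto
qed

section \<open>Labelled point sets under embedding\<close>

type_synonym labelled_points = "nat set \<times> (nat \<Rightarrow> nat) \<times> (nat \<Rightarrow> nat) \<times> (nat \<Rightarrow> nat)"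

text \<open>When x and y are injective on P, preserving strict inequalities already makes
  \<open>f\<close> injective and order reflecting, so this is pattern containment respecting
  labels.\<close>

fun points_emb :: "(nat \<Rightarrow> nat \<Rightarrow> bool) \<Rightarrow> labelled_points \<Rightarrow> labelled_points \<Rightarrow> bool" where
  "points_emb R (P, x, y, l) (P', x', y', l') \<longleftrightarrow> (\<exists>f. \<forall>p\<in>P. f p \<in> P' \<and> R (l p) (l' (f p)) \<and>
     (\<forall>q\<in>P. (x p < x q \<longrightarrow> x' (f p) < x' (f q)) \<and> (y p < y q \<longrightarrow> y' (f p) < y' (f q))))"

definition labelled_class :: "nat list set \<Rightarrow> labelled_points set" where
  "labelled_class C = {(P, x, y, l). finite P \<and> inj_on x P \<and> inj_on y P \<and> pattern_in C P x y}"

lemma points_emb_mono: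
  assumes "points_emb R w (Q, x, y, l)" "Q \<subseteq> P"
  shows "points_emb R w (P, x, y, l)"
proof -
  obtain P' x' y' l' where w: "w = (P', x', y', l')" by (cases w)
  obtain f where "\<forall>p\<in>P'. f p \<in> Q \<and> R (l' p) (l (f p)) \<and>
     (\<forall>q\<in>P'. (x' p < x' q \<longrightarrow> x (f p) < x (f q)) \<and> (y' p < y' q \<longrightarrow> y (f p) < y (f q)))"
    using assms(1) by (auto simp: w)
  then have "\<forall>p\<in>P'. f p \<in> P \<and> R (l' p) (l (f p)) \<and>
     (\<forall>q\<in>P'. (x' p < x' q \<longrightarrow> x (f p) < x (f q)) \<and> (y' p < y' q \<longrightarrow> y (f p) < y (f q)))"
    using assms(2) by (metis subsetD)
  then show ?thesis unfolding w points_emb.simps by (rule exI[of _ f])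
qed

text \<open>Each block is mapped by its own embedding. Points in different blocks are ordered by
  \<sigma> on both sides, so no condition links the embeddings of different blocks.\<close>

lemma inflation_emb:
  assumes "inflation P x y \<sigma> t" "inflation P' x' y' \<sigma> t'"
    and "\<And>a. a < length \<sigma> \<Longrightarrow>
      points_emb R ({p \<in> P. t p = a}, x, y, l) ({p \<in> P'. t' p = a}, x', y', l')"
  shows "points_emb R (P, x, y, l) (P', x', y', l')"
proof -
  define ok where "ok a f \<longleftrightarrow> (\<forall>p\<in>{p \<in> P. t p = a}. f p \<in> {p \<in> P'. t' p = a} \<and> R (l p) (l' (f p)) \<and>
     (\<forall>q\<in>{p \<in> P. t p = a}. (x p < x q \<longrightarrow> x' (f p) < x' (f q)) \<and> (y p < y q \<longrightarrow> y' (f p) < y' (f q))))"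
    for a and f :: "nat \<Rightarrow> nat"
  have "\<forall>a. \<exists>f. a < length \<sigma> \<longrightarrow> ok a f"
    using assms(3) unfolding points_emb.simps ok_def by blast
  then obtain f where "\<And>a. a < length \<sigma> \<Longrightarrow> ok a (f a)" by metis
  then have f: "\<And>a p. a < length \<sigma> \<Longrightarrow> p \<in> P \<Longrightarrow> t p = a \<Longrightarrow>
      f a p \<in> P' \<and> t' (f a p) = a \<and> R (l p) (l' (f a p))"
    "\<And>a p q. a < length \<sigma> \<Longrightarrow> p \<in> P \<Longrightarrow> t p = a \<Longrightarrow> q \<in> P \<Longrightarrow> t q = a \<Longrightarrow>
       (x p < x q \<longrightarrow> x' (f a p) < x' (f a q)) \<and> (y p < y q \<longrightarrow> y' (f a p) < y' (f a q))"
    unfolding ok_def by blast+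
  have t: "t p < length \<sigma>" if "p \<in> P" for p using assms(1) that by (auto simp: inflation_def)
  show ?thesis
    unfolding points_emb.simps
  proof (intro exI[of _ "\<lambda>p. f (t p) p"] ballI conjI)
    fix p q assume p: "p \<in> P" and q: "q \<in> P"
    let ?p' = "f (t p) p" and ?q' = "f (t q) q"
    have p': "?p' \<in> P'" "t' ?p' = t p" and q': "?q' \<in> P'" "t' ?q' = t q"
      using f(1)[OF t[OF p] p refl] f(1)[OF t[OF q] q refl] by simp_all
    have "(x p < x q \<longrightarrow> x' ?p' < x' ?q') \<and> (y p < y q \<longrightarrow> y' ?p' < y' ?q')"
    proof (cases "t p = t q")
      case True
      then show ?thesis using f(2)[OF t[OF p] p refl q] by simp
    next
      case False
      have "(x p < x q \<longleftrightarrow> t p < t q) \<and> (y p < y q \<longleftrightarrow> \<sigma> ! t p < \<sigma> ! t q)"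
        using assms(1) p q False unfolding inflation_def by blast
      moreover have "t' ?p' \<noteq> t' ?q'" using False by (simp add: p'(2) q'(2))
      then have "(x' ?p' < x' ?q' \<longleftrightarrow> t' ?p' < t' ?q') \<and> (y' ?p' < y' ?q' \<longleftrightarrow> \<sigma> ! t' ?p' < \<sigma> ! t' ?q')"
        using assms(2) p'(1) q'(1) \<open>t' ?p' \<noteq> t' ?q'\<close> unfolding inflation_def by blast
      ultimately show ?thesis by (simp add: p'(2) q'(2))
    qed
    then show "x p < x q \<longrightarrow> x' ?p' < x' ?q'" "y p < y q \<longrightarrow> y' ?p' < y' ?q'" by blast+
    show "?p' \<in> P'" by (rule p'(1))
    show "R (l p) (l' ?p')" using f(1)[OF t[OF p] p refl] by simp
  qed
qed

text \<open>The blocks of an inflation of a simple permutation are smaller members of the class, and only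
  finitely many simple permutations occur, so Higman's theorem applies to the lists of blocks.\<close>

theorem wqo_on_labelled_class:
  assumes C: "perm_class C" and fin: "finite {\<sigma> \<in> C. simple_perm \<sigma>}" and R: "wqo_on R UNIV"
  shows "wqo_on (points_emb R) (labelled_class C)"
proof -
  \<comment> \<open>\<open>sub\<close> must be a function of the labelled set, so one decomposition
    is chosen for each.\<close>
  define dec where "dec = (\<lambda>(P, x, y, l :: nat \<Rightarrow> nat). SOME (\<sigma>, t). \<sigma> \<in> C \<and> simple_perm \<sigma> \<and> 2 \<le> length \<sigma> \<and>
    inflation P x y \<sigma> t)"
  have dec: "\<sigma> \<in> C \<and> simple_perm \<sigma> \<and> 2 \<le> length \<sigma> \<and> inflation P x y \<sigma> t"
    if "(P, x, y, l) \<in> labelled_class C" "2 \<le> card P" "dec (P, x, y, l) = (\<sigma>, t)" for P x y l \<sigma> t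
  proof -
    have "\<exists>\<sigma>t. case \<sigma>t of (\<sigma>, t) \<Rightarrow> \<sigma> \<in> C \<and> simple_perm \<sigma> \<and> 2 \<le> length \<sigma> \<and> inflation P x y \<sigma> t"
      using ex_simple_inflation[OF C, of P x y] that by (auto simp: labelled_class_def)
    from someI_ex[OF this] show ?thesis using that(3) by (simp add: dec_def split: prod.splits)
  qed
  define block :: "labelled_points \<Rightarrow> nat \<Rightarrow> labelled_points" where
    "block z a = (case z of (P, x, y, l) \<Rightarrow> ({p \<in> P. snd (dec z) p = a}, x, y, l))" for z a
  define sub where "sub z = (if card (fst z) < 2 then {} else block z ` {..<length (fst (dec z))})" for z
  show ?thesis
  proof (rule wqo_on_minimal_bad[where sub = sub and size = "\<lambda>z. card (fst z)"])
    fix z w assume z: "z \<in> labelled_class C" and w: "w \<in> sub z"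
    obtain P x y l where zP: "z = (P, x, y, l)" by (cases z)
    obtain \<sigma> t where \<sigma>t: "dec z = (\<sigma>, t)" by (cases "dec z")
    obtain a where a: "a < length \<sigma>" "w = ({p \<in> P. t p = a}, x, y, l)" and card: "2 \<le> card P"
      using w zP \<sigma>t by (auto simp: sub_def block_def split: if_splits)
    have d: "2 \<le> length \<sigma>" "inflation P x y \<sigma> t" using dec z card \<sigma>t zP by blast+
    have P: "finite P" "inj_on x P" "inj_on y P" "pattern_in C P x y"
      using z by (auto simp: zP labelled_class_def)
    have "w \<in> labelled_class C"
      using P pattern_in_subset[OF C P(4,1,2,3)]
      by (auto simp: a labelled_class_def intro: inj_on_subset)
    moreover have "card {p \<in> P. t p = a} < card P"
    proof (rule psubset_card_mono[OF P(1)])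
      obtain b where "b < length \<sigma>" "b \<noteq> a"
        using d(1) by (metis One_nat_def Suc_1 Suc_le_lessD less_le_trans zero_less_one n_not_Suc_n zero_less_Suc)
      then have "b \<in> t ` P" using d(2) by (auto simp: inflation_def)
      then show "{p \<in> P. t p = a} \<subset> P" using \<open>b \<noteq> a\<close> by auto
    qed
    ultimately show "w \<in> labelled_class C \<and> card (fst w) < card (fst z)"
      by (simp add: a zP)
  next
    fix v w z assume "w \<in> sub z" "points_emb R v w"
    then show "points_emb R v z"
      using points_emb_mono[of R v] by (auto simp: sub_def block_def split: if_splits prod.splits)
  next
    fix B assume B: "wqo_on (points_emb R) B"
    let ?small = "{z \<in> labelled_class C. card (fst z) < 2}"
    let ?infl = "\<lambda>\<sigma>. {z \<in> labelled_class C. 2 \<le> card (fst z) \<and> fst (dec z) = \<sigma> \<and> sub z \<subseteq> B}"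
    \<comment> \<open>A set with at most one point is described by its size and the label of that
      point. On the empty set \<open>the_elem\<close> has an arbitrary value, which is harmless
      because the empty set embeds everywhere.\<close>
    have "wqo_on (points_emb R) ?small"
    proof (rule wqo_on_map[OF wqo_on_Times[OF wqo_on_le_nat R],
          where f = "\<lambda>(P, x, y, l). (card P, l (the_elem P))"])
      fix z z' assume z: "z \<in> ?small" "z' \<in> ?small"
      obtain P x y l P' x' y' l' where eq: "z = (P, x, y, l)" "z' = (P', x', y', l')"
        by (cases z, cases z')
      have fP: "finite P" "finite P'" "card P < 2" "card P' < 2"
        using z by (auto simp: eq labelled_class_def)
      assume "(\<lambda>(a, b) (a', b'). a \<le> a' \<and> R b b') ((\<lambda>(P, x, y, l). (card P, l (the_elem P))) z)
        ((\<lambda>(P, x, y, l). (card P, l (the_elem P))) z')"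
      then have c: "card P \<le> card P'" "R (l (the_elem P)) (l' (the_elem P'))" by (auto simp: eq)
      show "points_emb R z z'"
      proof (cases "P = {}")
        case True then show ?thesis by (simp add: eq)
      next
        case False
        then have "card P > 0" using fP by (simp add: card_gt_0_iff)
        then have "card P = 1" "card P' = 1" using fP c by linarith+
        then obtain p p' where "P = {p}" "P' = {p'}" by (meson card_1_singletonE)
        then show ?thesis using c(2) by (auto simp: eq)
      qed
    qed auto
    \<comment> \<open>For fixed \<sigma> all lists of blocks have the same length, so an embedding
      of lists matches blocks at equal positions.\<close>
    moreover have "wqo_on (points_emb R) (?infl \<sigma>)" for \<sigma>
    proof (rule wqo_on_map[OF Higman[OF B], where f = "\<lambda>z. map (block z) [0..<length \<sigma>]"])
      fix z assume "z \<in> ?infl \<sigma>"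
      then have "block z ` {..<length \<sigma>} \<subseteq> B" by (auto simp only: sub_def split: if_splits)
      then show "map (block z) [0..<length \<sigma>] \<in> lists B" by (auto simp: image_subset_iff)
    next
      fix z z' assume z: "z \<in> ?infl \<sigma>" "z' \<in> ?infl \<sigma>"
        and emb: "list_emb (points_emb R) (map (block z) [0..<length \<sigma>]) (map (block z') [0..<length \<sigma>])"
      obtain P x y l P' x' y' l' where eq: "z = (P, x, y, l)" "z' = (P', x', y', l')"
        by (cases z, cases z')
      have "fst (dec z) = \<sigma>" "fst (dec z') = \<sigma>" using z by blast+
      then obtain t t' where t: "dec (P, x, y, l) = (\<sigma>, t)" "dec (P', x', y', l') = (\<sigma>, t')"
        unfolding eq by (metis prod.collapse)
      have block: "block z a = ({p \<in> P. t p = a}, x, y, l)"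
        "block z' a = ({p \<in> P'. t' p = a}, x', y', l')" for a
        by (simp_all add: block_def eq t)
      have "points_emb R ({p \<in> P. t p = a}, x, y, l) ({p \<in> P'. t' p = a}, x', y', l')"
        if "a < length \<sigma>" for a
        using list_emb_same_length[OF emb, of a] that by (simp add: block)
      moreover have "inflation P x y \<sigma> t" "inflation P' x' y' \<sigma> t'"
        using z dec[OF _ _ t(1)] dec[OF _ _ t(2)] by (simp_all add: eq)
      ultimately show "points_emb R z z'"
        unfolding eq using inflation_emb by blast
    qed
    ultimately have "wqo_on (points_emb R) (?small \<union> (\<Union>\<sigma>\<in>{\<sigma> \<in> C. simple_perm \<sigma>}. ?infl \<sigma>))"
      using fin by (intro wqo_on_Un wqo_on_UN)
    moreover have "{z \<in> labelled_class C. sub z \<subseteq> B} \<subseteq> ?small \<union> (\<Union>\<sigma>\<in>{\<sigma> \<in> C. simple_perm \<sigma>}. ?infl \<sigma>)"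
    proof
      fix z assume z: "z \<in> {z \<in> labelled_class C. sub z \<subseteq> B}"
      obtain P x y l where zP: "z = (P, x, y, l)" by (cases z)
      obtain \<sigma> t where \<sigma>t: "dec z = (\<sigma>, t)" by (cases "dec z")
      show "z \<in> ?small \<union> (\<Union>\<sigma>\<in>{\<sigma> \<in> C. simple_perm \<sigma>}. ?infl \<sigma>)"
        using z \<sigma>t dec[of P x y l \<sigma> t] by (cases "card P < 2") (simp_all add: zP)
    qed
    ultimately show "wqo_on (points_emb R) {z \<in> labelled_class C. sub z \<subseteq> B}"
      by (rule wqo_on_subset)
  qed
qed

section \<open>An elimination order for the cells of a forest\<close>

text \<open>The bound 3 rules out running back and forth along one edge, in agreement with
  \<open>undirected_forest\<close>.\<close>

definition has_cycle :: "('a \<Rightarrow> 'a \<Rightarrow> bool) \<Rightarrow> bool" where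
  "has_cycle E \<longleftrightarrow> (\<exists>xs. 3 \<le> length xs \<and> distinct xs \<and> successively E xs \<and> E (last xs) (hd xs))"

lemma has_cycle_mono:
  assumes "has_cycle E" "\<And>a b. E a b \<Longrightarrow> F a b"
  shows "has_cycle F"
  using assms unfolding has_cycle_def by (metis successively_mono)

text \<open>A path that cannot be prolonged beyond x contains all neighbours of x, and a neighbour
  further along than the second vertex would close a cycle.\<close>

lemma maximal_path_end:
  assumes "\<not> has_cycle E" "symp E" "\<And>a. \<not> E a a"
    and "distinct (x # xs)" "successively E (x # xs)"
    and max: "\<And>z. E z x \<Longrightarrow> z \<in> set xs" and z: "E x z"
  shows "xs \<noteq> [] \<and> z = hd xs"
proof -
  have zx: "E z x" using z assms(2) by (simp add: sympD)
  then have "z \<in> set xs" by (rule max)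
  then obtain us vs where us: "xs = us @ z # vs" by (meson split_list)
  have "us = []"
  proof (rule ccontr)
    assume "us \<noteq> []"
    let ?c = "x # us @ [z]"
    have "successively E ?c" "distinct ?c"
      using assms(4,5) \<open>us \<noteq> []\<close> by (auto simp: us successively_Cons successively_append_iff)
    moreover have "3 \<le> length ?c" using \<open>us \<noteq> []\<close> by (cases us) auto
    ultimately have "has_cycle E" unfolding has_cycle_def using zx by (intro exI[of _ ?c]) simp
    then show False using assms(1) by blast
  qed
  then show ?thesis by (simp add: us)
qed

lemma successively_rtranclp: "successively E (x # xs) \<Longrightarrow> E\<^sup>*\<^sup>* x (last (x # xs))"
  by (induction xs arbitrary: x) (auto simp: successively_Cons intro: converse_rtranclp_into_rtranclp)

text \<open>N stands for the non-monotone cells. If the longest path is a single vertex, that vertex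
  has no neighbour and may belong to N; otherwise the two ends are distinct and connected, so N
  misses one of them.\<close>

lemma ex_removable_vertex:
  assumes fin: "finite V" "V \<noteq> {}" and E: "\<And>a b. E a b \<Longrightarrow> a \<in> V \<and> b \<in> V \<and> a \<noteq> b" "symp E"
    and acyc: "\<not> has_cycle E"
    and N: "\<And>c d. c \<in> N \<Longrightarrow> d \<in> N \<Longrightarrow> E\<^sup>*\<^sup>* c d \<Longrightarrow> c = d"
  shows "\<exists>c\<in>V. (\<forall>z. \<not> E c z) \<or> c \<notin> N \<and> (\<forall>z z'. E c z \<longrightarrow> E c z' \<longrightarrow> z = z')"
proof -
  define path where "path xs \<longleftrightarrow> xs \<noteq> [] \<and> set xs \<subseteq> V \<and> distinct xs \<and> successively E xs" for xs
  obtain v where "v \<in> V" using fin(2) by blast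
  then have "path [v]" by (simp add: path_def)
  moreover have "length xs < Suc (card V)" if "path xs" for xs
    using card_mono[OF fin(1), of "set xs"] that by (simp add: path_def distinct_card)
  ultimately obtain xs where xs: "path xs" "\<And>ys. path ys \<Longrightarrow> length ys \<le> length xs"
    using ex_has_greatest_nat[of path "[v]" length "Suc (card V)"] by blast
  have irr: "\<not> E a a" for a using E(1) by blast
  have "end": "ys \<noteq> [] \<and> z = hd ys" if p: "path (y # ys)" "length (y # ys) = length xs" and z: "E y z" for y ys z
  proof (rule maximal_path_end[OF acyc E(2) irr _ _ _ z])
    fix w assume w: "E w y"
    show "w \<in> set ys"
    proof (rule ccontr)
      assume "w \<notin> set ys"
      then have "path (w # y # ys)" using p(1) w E(1)[OF w] by (auto simp: path_def)
      then show False using xs(2)[of "w # y # ys"] p(2) by simp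
    qed
  qed (use p in \<open>auto simp: path_def\<close>)
  obtain y ys where y: "xs = y # ys" using xs(1) by (cases xs) (auto simp: path_def)
  have y_end: "z = z' \<and> ys \<noteq> []" if "E y z" "E y z'" for z z'
    using "end"[of y ys z] "end"[of y ys z'] that xs(1) by (simp add: y)
  obtain w ws where w: "rev xs = w # ws" using xs(1) by (cases "rev xs") (auto simp: path_def)
  \<comment> \<open>The reversed path is longest as well, so the argument for a first vertex also
    covers the last vertex of \<open>xs\<close>.\<close>
  have "successively E (rev xs)" using xs(1) E(2)
    unfolding successively_rev path_def by (metis (mono_tags, lifting) successively_mono sympD)
  then have "path (rev xs)" using xs(1) by (simp add: path_def)
  then have w_end: "z = z'" if "E w z" "E w z'" for z z'
    using "end"[of w ws z] "end"[of w ws z'] that w by (metis length_rev)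
  have wl: "w = last xs" using w by (metis last_rev list.sel(1) rev_rev_ident list.distinct(1) rev_is_Nil_conv)
  have "y \<in> V" "w \<in> V" using xs(1) by (auto simp: path_def y wl)
  show ?thesis
  proof (cases "ys = []")
    case True
    then show ?thesis using y_end \<open>y \<in> V\<close> by blast
  next
    case False
    have "E\<^sup>*\<^sup>* y w" using successively_rtranclp[of E y ys] xs(1) by (simp add: path_def y wl)
    moreover have "y \<noteq> w" using xs(1) False by (auto simp: path_def y wl)
    ultimately have "y \<notin> N \<or> w \<notin> N" using N by blast
    then show ?thesis using y_end w_end \<open>y \<in> V\<close> \<open>w \<in> V\<close> by blast
  qed
qed

section \<open>Adjacency of cells and their removal\<close>

type_synonym cell = "nat \<times> nat"

text \<open>\<open>cell_adj\<close> with membership in V in place of nonemptiness, so that cells can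
  be removed without changing the matrix.\<close>

definition line_adj :: "cell set \<Rightarrow> cell \<Rightarrow> cell \<Rightarrow> bool" where
  "line_adj V c d \<longleftrightarrow> c \<in> V \<and> d \<in> V \<and> c \<noteq> d \<and>
     (fst c = fst d \<and> (\<forall>t. min (snd c) (snd d) < t \<and> t < max (snd c) (snd d) \<longrightarrow> (fst c, t) \<notin> V) \<or>
      snd c = snd d \<and> (\<forall>t. min (fst c) (fst d) < t \<and> t < max (fst c) (fst d) \<longrightarrow> (t, snd c) \<notin> V))"

lemma symp_line_adj: "symp (line_adj V)"
  by (auto simp: symp_def line_adj_def min.commute max.commute)

lemma line_adj_swap: "line_adj (prod.swap ` V) (prod.swap c) (prod.swap d) \<longleftrightarrow> line_adj V c d"
proof -
  have *: "(a, b) \<in> prod.swap ` V \<longleftrightarrow> (b, a) \<in> V" for a b by (force simp: image_iff)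
  show ?thesis by (cases c; cases d) (auto simp: line_adj_def *)
qed

text \<open>A nearest other cell of the column has no cell of V in between.\<close>

lemma ex_line_adj_column:
  assumes "c \<in> V" "d \<in> V" "c \<noteq> d" "fst c = fst d"
  shows "\<exists>z. line_adj V c z \<and> fst z = fst c"
proof -
  define gap where "gap z = max (snd c) (snd z) - min (snd c) (snd z)" for z :: cell
  obtain z where z: "z \<in> V" "z \<noteq> c" "fst z = fst c"
    and z_min: "\<And>z'. z' \<in> V \<Longrightarrow> z' \<noteq> c \<Longrightarrow> fst z' = fst c \<Longrightarrow> gap z \<le> gap z'"
    using ex_has_least_nat[of "\<lambda>z. z \<in> V \<and> z \<noteq> c \<and> fst z = fst c" d gap] assms by auto
  have "(fst c, t) \<notin> V" if t: "min (snd c) (snd z) < t" "t < max (snd c) (snd z)" for t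
  proof
    assume "(fst c, t) \<in> V"
    moreover have "(fst c, t) \<noteq> c" using t by (cases c) auto
    ultimately have "gap z \<le> gap (fst c, t)" by (intro z_min) auto
    then show False using t by (auto simp: gap_def min_def max_def split: if_splits)
  qed
  then have "line_adj V c z" using z assms(1) by (auto simp: line_adj_def)
  then show ?thesis using z by blast
qed

lemma ex_line_adj_row:
  assumes "c \<in> V" "d \<in> V" "c \<noteq> d" "snd c = snd d"
  shows "\<exists>z. line_adj V c z \<and> snd z = snd c"
proof -
  have "prod.swap c \<in> prod.swap ` V" "prod.swap d \<in> prod.swap ` V" "prod.swap c \<noteq> prod.swap d"
    using assms by (auto simp: prod_eq_iff)
  from ex_line_adj_column[OF this] obtain z
    where "line_adj (prod.swap ` V) (prod.swap c) z" "fst z = snd c" using assms(4) by auto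
  then show ?thesis using line_adj_swap[of V c "prod.swap z"] by (intro exI[of _ "prod.swap z"]) simp
qed

text \<open>Deleting c can create an adjacency only between two cells that c alone separated. Both
  would be neighbours of c, against uniqueness.\<close>

lemma line_adj_remove:
  assumes uniq: "\<And>z z'. line_adj V c z \<Longrightarrow> line_adj V c z' \<Longrightarrow> z = z'" and "c \<in> V"
    and adj: "line_adj (V - {c}) d e"
  shows "line_adj V d e"
proof -
  \<comment> \<open>Stated for arbitrary V, c, d, e so that the row case can use it on the
    transposed cells.\<close>
  have col: "line_adj V d e" 
    if V: "\<And>z z'. line_adj V c z \<Longrightarrow> line_adj V c z' \<Longrightarrow> z = z'" "c \<in> V"
      "d \<in> V" "e \<in> V" "d \<noteq> e" "d \<noteq> c" "e \<noteq> c" "fst d = fst e"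
      and none: "\<And>t. min (snd d) (snd e) < t \<Longrightarrow> t < max (snd d) (snd e) \<Longrightarrow> (fst d, t) \<in> V \<Longrightarrow> (fst d, t) = c"
    for V c d e
  proof (rule ccontr)
    assume "\<not> line_adj V d e"
    then obtain t where t: "min (snd d) (snd e) < t" "t < max (snd d) (snd e)" "(fst d, t) \<in> V"
      using V(3,4,5,8) by (auto simp: line_adj_def)
    then have c: "c = (fst d, t)" using none by blast
    have free: "(fst d, s) \<notin> V" if "min (snd c) (snd z) < s" "s < max (snd c) (snd z)" "z = d \<or> z = e" for s z
    proof
      assume "(fst d, s) \<in> V"
      moreover have "min (snd d) (snd e) < s" "s < max (snd d) (snd e)" "s \<noteq> t"
        using that t(1,2) V(8) by (auto simp: c)
      ultimately show False using none[of s] c by simp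
    qed
    have "line_adj V c z" if "z = d \<or> z = e" for z
    proof -
      have "\<forall>t. min (snd c) (snd z) < t \<and> t < max (snd c) (snd z) \<longrightarrow> (fst c, t) \<notin> V"
        using that free[of z] c by simp
      moreover have "z \<in> V" "c \<noteq> z" "fst c = fst z" using that V c by auto
      ultimately show ?thesis using V(2) by (simp add: line_adj_def)
    qed
    then have "line_adj V c d" "line_adj V c e" by blast+
    then show False using V(1,5) by blast
  qed
  have V: "d \<in> V" "e \<in> V" "d \<noteq> e" "d \<noteq> c" "e \<noteq> c" using adj by (auto simp: line_adj_def)
  consider
    "fst d = fst e" "\<And>t. min (snd d) (snd e) < t \<Longrightarrow> t < max (snd d) (snd e) \<Longrightarrow> (fst d, t) \<notin> V - {c}"
  | "snd d = snd e" "\<And>t. min (fst d) (fst e) < t \<Longrightarrow> t < max (fst d) (fst e) \<Longrightarrow> (t, snd d) \<notin> V - {c}"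
    using adj by (auto simp: line_adj_def)
  then show ?thesis
  proof cases
    case 1
    then show ?thesis using col[of V c d e] uniq \<open>c \<in> V\<close> V by blast
  next
    case 2
    let ?s = "prod.swap :: cell \<Rightarrow> cell"
    have "line_adj (?s ` V) (?s d) (?s e)"
    proof (rule col[of _ "?s c"])
      fix z z' assume "line_adj (?s ` V) (?s c) z" "line_adj (?s ` V) (?s c) z'"
      then have "line_adj V c (?s z)" "line_adj V c (?s z')"
        using line_adj_swap[of V c "?s z"] line_adj_swap[of V c "?s z'"] by simp_all
      then have "?s z = ?s z'" by (rule uniq)
      then show "z = z'" by (metis swap_swap)
    next
      fix t assume "min (snd (?s d)) (snd (?s e)) < t" "t < max (snd (?s d)) (snd (?s e))"
        "(fst (?s d), t) \<in> ?s ` V"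
      then show "(fst (?s d), t) = ?s c" using 2(2)[of t] by (cases c) (auto simp: prod.swap_def)
    qed (use V \<open>c \<in> V\<close> 2(1) in \<open>auto simp: prod_eq_iff\<close>)
    then show ?thesis by (simp add: line_adj_swap)
  qed
qed

text \<open>The last two rules are named after the line in which the new cell is alone: under
  \<open>column\<close> it may still share its row.\<close>

inductive buildable :: "cell set \<Rightarrow> cell set \<Rightarrow> bool" for N where
  empty: "buildable N {}"
| isolated: "buildable N S \<Longrightarrow> \<forall>d\<in>S. fst d \<noteq> fst c \<and> snd d \<noteq> snd c \<Longrightarrow> buildable N (insert c S)"
| column: "buildable N S \<Longrightarrow> c \<notin> N \<Longrightarrow> \<forall>d\<in>S. fst d \<noteq> fst c \<Longrightarrow> buildable N (insert c S)"
| row: "buildable N S \<Longrightarrow> c \<notin> N \<Longrightarrow> \<forall>d\<in>S. snd d \<noteq> snd c \<Longrightarrow> buildable N (insert c S)"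

text \<open>By \<open>line_adj_remove\<close>, adjacency after the removal of a suitable cell is
  contained in the old adjacency, so acyclicity and the condition on N are inherited.\<close>

lemma buildable_forest:
  assumes "finite V" "\<not> has_cycle (line_adj V)"
    and "\<And>c d. c \<in> N \<Longrightarrow> d \<in> N \<Longrightarrow> (line_adj V)\<^sup>*\<^sup>* c d \<Longrightarrow> c = d"
  shows "buildable N V"
  using assms
proof (induction "card V" arbitrary: V)
  case 0
  then show ?case by (simp add: buildable.empty)
next
  case (Suc k)
  have "V \<noteq> {}" using Suc.hyps(2) by auto
  have "\<exists>c\<in>V. (\<forall>z. \<not> line_adj V c z) \<or>
      c \<notin> N \<and> (\<forall>z z'. line_adj V c z \<longrightarrow> line_adj V c z' \<longrightarrow> z = z')"
    by (rule ex_removable_vertex[OF Suc.prems(1) \<open>V \<noteq> {}\<close> _ symp_line_adj Suc.prems(2) Suc.prems(3)])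
      (simp_all add: line_adj_def)
  then obtain c where c: "c \<in> V"
    "(\<forall>z. \<not> line_adj V c z) \<or> c \<notin> N \<and> (\<forall>z z'. line_adj V c z \<longrightarrow> line_adj V c z' \<longrightarrow> z = z')"
    by blast
  have mono: "line_adj (V - {c}) d e \<Longrightarrow> line_adj V d e" for d e
    using line_adj_remove[of V c d e] c by blast
  have "buildable N (V - {c})"
  proof (rule Suc.hyps(1))
    show "k = card (V - {c})" using Suc.hyps(2) c(1) Suc.prems(1) by simp
    show "\<not> has_cycle (line_adj (V - {c}))" using Suc.prems(2) has_cycle_mono mono by blast
    show "a = b" if "a \<in> N" "b \<in> N" "(line_adj (V - {c}))\<^sup>*\<^sup>* a b" for a b
      using Suc.prems(3)[OF that(1,2)] that(3) mono by (metis mono_rtranclp)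
  qed (use Suc.prems in auto)
  moreover have "V = insert c (V - {c})" using c(1) by blast
  moreover have "fst d \<noteq> fst c" if "d \<in> V - {c}" "\<And>z. line_adj V c z \<Longrightarrow> fst z \<noteq> fst c" for d
    using ex_line_adj_column[of c V d] that c(1) by (metis DiffD1 DiffD2 singletonI)
  moreover have "snd d \<noteq> snd c" if "d \<in> V - {c}" "\<And>z. line_adj V c z \<Longrightarrow> snd z \<noteq> snd c" for d
    using ex_line_adj_row[of c V d] that c(1) by (metis DiffD1 DiffD2 singletonI)
  \<comment> \<open>No cell other than c agrees with it in both coordinates, so a unique neighbour
    leaves the column or the row of c without neighbours and hence, by the preceding facts, without
    other cells.\<close>
  moreover have "(\<forall>z. line_adj V c z \<longrightarrow> fst z \<noteq> fst c) \<or> (\<forall>z. line_adj V c z \<longrightarrow> snd z \<noteq> snd c)"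
    using c(2) by (metis line_adj_def prod_eq_iff)
  ultimately show ?case using c(2) by (metis buildable.isolated buildable.column buildable.row)
qed

text \<open>A cell strictly between two cells of the matrix has indices in range, so its absence
  from \<open>nonempty_cells\<close> means that its class is empty.\<close>

lemma line_adj_cell_adj:
  assumes "line_adj (nonempty_cells m n M) c d"
  shows "(c, d) \<in> parcs (grid_graph m n M)"
proof -
  obtain i j k l where eq: "c = (i, j)" "d = (k, l)" by (cases c, cases d)
  show ?thesis
    using assms by (auto simp: eq line_adj_def grid_graph_def cell_adj_def nonempty_cells_def)
qed

lemma no_cycle_grid_graph:
  assumes "undirected_forest (grid_graph m n M)"
  shows "\<not> has_cycle (line_adj (nonempty_cells m n M))"
proof
  let ?G = "with_proj (grid_graph m n M)"
  assume "has_cycle (line_adj (nonempty_cells m n M))"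
  then obtain xs where xs: "3 \<le> length xs" "distinct xs"
    "successively (\<lambda>c d. (c, d) \<in> arcs ?G) xs" "(last xs, hd xs) \<in> arcs ?G"
    "hd xs \<in> nonempty_cells m n M"
  proof -
    obtain xs where xs: "3 \<le> length xs" "distinct xs"
      "successively (line_adj (nonempty_cells m n M)) xs"
      "line_adj (nonempty_cells m n M) (last xs) (hd xs)"
      using \<open>has_cycle _\<close> unfolding has_cycle_def by blast
    have "successively (\<lambda>c d. (c, d) \<in> arcs ?G) xs"
      using xs(3) by (rule successively_mono) (auto intro: line_adj_cell_adj)
    moreover have "hd xs \<in> nonempty_cells m n M" using xs(4) by (simp add: line_adj_def)
    ultimately show thesis
      using that[of xs] xs(1,2) line_adj_cell_adj[OF xs(4)] by simp
  qed
  have cas: "pre_digraph.cas ?G (hd ys) (zip ys (tl ys @ [z])) z" if "ys \<noteq> []" for ys z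
    using that
  proof (induction ys)
    case (Cons y ys)
    then show ?case by (cases ys) (auto simp: pre_digraph.cas.simps)
  qed simp
  have arcs: "set (zip ys (tl ys @ [z])) \<subseteq> arcs ?G"
    if "ys \<noteq> []" "successively (\<lambda>c d. (c, d) \<in> arcs ?G) ys" "(last ys, z) \<in> arcs ?G" for ys z
    using that
  proof (induction ys)
    case (Cons y ys)
    then show ?case by (cases ys) auto
  qed simp
  \<comment> \<open>The closed walk as a list of arcs: each vertex is paired with its successor, the
    last one with the first.\<close>
  define p where "p = zip xs (tl xs @ [hd xs])"
  have ne: "xs \<noteq> []" using xs(1) by auto
  have len: "length p = length xs" using ne by (simp add: p_def)
  have "pre_digraph.awalk ?G (hd xs) p (hd xs)"
    unfolding pre_digraph.awalk_def p_def
    using cas[OF ne] arcs[OF ne xs(3,4)] xs(5) ne by (auto simp: grid_graph_def)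
  moreover have "pre_digraph.awalk_verts ?G (hd xs) p = xs @ [hd xs]"
  proof -
    have "p \<noteq> []" using len ne by auto
    moreover have "map fst p = xs" using ne by (simp add: p_def)
    moreover have "snd (last p) = hd xs"
      using ne len by (simp add: p_def last_conv_nth nth_append)
    ultimately show ?thesis by (simp add: pre_digraph.awalk_verts_conv)
  qed
  then have "distinct (tl (pre_digraph.awalk_verts ?G (hd xs) p))"
    using xs(2) ne by (cases xs) auto
  ultimately have "pre_digraph.cycle ?G p"
    unfolding pre_digraph.cycle_def using len ne by (intro exI[of _ "hd xs"]) auto
  then show False using assms xs(1) len by (auto simp: undirected_forest_def)
qed

text \<open>In a symmetric digraph the vertices reachable from c form a strongly connected
  component, and both c and d belong to it.\<close>

lemma line_adj_component:
  assumes "\<And>K. K \<in> components_verts (grid_graph m n M) \<Longrightarrow> card {c \<in> K. Q c} \<le> 1"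
    and cd: "c \<in> nonempty_cells m n M" "Q c" "Q d" "(line_adj (nonempty_cells m n M))\<^sup>*\<^sup>* c d"
  shows "c = d"
proof -
  interpret pair_graph "grid_graph m n M" by (rule pair_graph_grid_graph)
  let ?G = "with_proj (grid_graph m n M)"
  define K where "K = {v. reachable ?G c v}"
  have sym: "reachable ?G v u" if "reachable ?G u v" for u v
    using that symmetric_reachable[OF sym_arcs] by blast
  have "c \<in> pverts (grid_graph m n M)" using cd(1) by (simp add: grid_graph_def)
  then have cK: "c \<in> K" by (simp add: K_def)
  have "K \<in> components_verts (grid_graph m n M)"
    unfolding components_verts_def pre_digraph.sccs_verts_def K_def
  proof (intro CollectI conjI ballI allI impI)
    show "{v. reachable ?G c v} \<noteq> {}" using cK unfolding K_def by blast
    show "reachable ?G u v" if "u \<in> {v. reachable ?G c v}" "v \<in> {v. reachable ?G c v}" for u v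
      using that sym reachable_trans[of u c v] by simp
    show "\<not> reachable ?G u v \<or> \<not> reachable ?G v u"
      if "u \<in> {v. reachable ?G c v}" "v \<notin> {v. reachable ?G c v}" for u v
      using that reachable_trans[of c u v] by blast
  qed
  then have "card {v \<in> K. Q v} \<le> 1" by (rule assms(1))
  \<comment> \<open>The cardinality bound has content only for a finite set, as \<open>card\<close>
    of an infinite set is 0.\<close>
  moreover have "finite {v \<in> K. Q v}"
  proof (rule finite_subset)
    show "{v \<in> K. Q v} \<subseteq> verts ?G" by (auto simp: K_def dest: reachable_in_verts)
  qed simp
  moreover have "d \<in> K"
    using cd(4)
  proof (induction rule: rtranclp_induct)
    case base then show ?case by (rule cK)
  next
    case (step u v)
    then have "u \<rightarrow>\<^bsub>?G\<^esub> v" using line_adj_cell_adj by simp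
    then show ?case using step.IH by (auto simp: K_def intro: reachable_adj_trans)
  qed
  ultimately show ?thesis
    using cd(2,3) cK card_le_Suc0_iff_eq[of "{v \<in> K. Q v}"] unfolding One_nat_def by blast
qed

section \<open>Labelled gridded point sets\<close>

lemma ex_increasing_enumeration:
  fixes y :: "nat \<Rightarrow> nat"
  assumes "finite Q" "inj_on y Q"
  shows "\<exists>xs. set xs = Q \<and> (\<forall>b<length xs. \<forall>a<b. y (xs ! a) < y (xs ! b))"
proof (intro exI conjI allI impI)
  let ?ys = "sorted_list_of_set (y ` Q)"
  let ?xs = "map (inv_into Q y) ?ys"
  have ys: "set ?ys = y ` Q" using assms(1) by simp
  then show "set ?xs = Q" using assms(2) by (auto simp: image_image)
  fix a b assume ab: "b < length ?xs" "a < b"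
  have "y (?xs ! c) = ?ys ! c" if "c < length ?ys" for c
    using that ys nth_mem[OF that] by (simp add: f_inv_into_f)
  then show "y (?xs ! a) < y (?xs ! b)"
    using ab sorted_wrt_nth_less[of "(<)" ?ys a b] by (simp del: sorted_list_of_set.length_sorted_key_list_of_set)
qed

definition increasing_list :: "(nat \<Rightarrow> nat) \<Rightarrow> nat set \<Rightarrow> nat list" where
  "increasing_list y Q = (SOME xs. set xs = Q \<and> (\<forall>b<length xs. \<forall>a<b. y (xs ! a) < y (xs ! b)))"

lemma increasing_list:
  assumes "finite Q" "inj_on y Q"
  shows "set (increasing_list y Q) = Q"
    "a < b \<Longrightarrow> b < length (increasing_list y Q) \<Longrightarrow> y (increasing_list y Q ! a) < y (increasing_list y Q ! b)"
  using someI_ex[OF ex_increasing_enumeration[OF assms]] unfolding increasing_list_def by blast+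

lemma increasing_list_emb:
  assumes "finite Q" "inj_on y Q" "finite Q'" "inj_on y' Q'"
    and emb: "list_emb R (map l (increasing_list y Q)) (map l' (increasing_list y' Q'))"
  shows "\<exists>h. \<forall>p\<in>Q. h p \<in> Q' \<and> R (l p) (l' (h p)) \<and> (\<forall>q\<in>Q. y p < y q \<longrightarrow> y' (h p) < y' (h q))"
proof -
  let ?xs = "increasing_list y Q" and ?xs' = "increasing_list y' Q'"
  note xs = increasing_list[OF assms(1,2)] and xs' = increasing_list[OF assms(3,4)]
  obtain g where g0: "\<forall>a<length ?xs. g a < length ?xs' \<and> R (map l ?xs ! a) (map l' ?xs' ! g a)"
    and g_mono: "\<forall>a<length ?xs. \<forall>b<length ?xs. a < b \<longrightarrow> g a < g b"
    using emb unfolding list_emb_iff_nth length_map by blast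
  have g: "g a < length ?xs' \<and> R (l (?xs ! a)) (l' (?xs' ! g a))" if "a < length ?xs" for a
    using g0 that by auto
  have "\<forall>p\<in>Q. \<exists>a<length ?xs. ?xs ! a = p" using xs(1) by (metis in_set_conv_nth)
  then obtain k where k: "\<And>p. p \<in> Q \<Longrightarrow> k p < length ?xs" "\<And>p. p \<in> Q \<Longrightarrow> ?xs ! k p = p" by metis
  have k_less: "k p < k q" if "p \<in> Q" "q \<in> Q" "y p < y q" for p q
    using xs(2)[of "k q" "k p"] k[OF that(1)] k[OF that(2)] that(3)
    by (metis linorder_neqE_nat less_asym less_irrefl)
  have "?xs' ! g (k p) \<in> Q'" if "p \<in> Q" for p
    using g[of "k p"] k(1)[OF that] xs'(1) nth_mem by blast
  moreover have "R (l p) (l' (?xs' ! g (k p)))" if "p \<in> Q" for p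
    using g[of "k p"] k[OF that] by simp
  moreover have "y' (?xs' ! g (k p)) < y' (?xs' ! g (k q))" if "p \<in> Q" "q \<in> Q" "y p < y q" for p q
    using xs'(2) g[of "k q"] g_mono k(1)[OF that(1)] k(1)[OF that(2)] k_less[OF that]
    by blast
  ultimately show ?thesis by (intro exI[of _ "\<lambda>p. ?xs' ! g (k p)"]) blast
qed

text \<open>The points of \<open>Q\<close> directly above the point \<open>p\<close> of \<open>B\<close> if \<open>w = Some p\<close>, and below all of \<open>B\<close>
  if \<open>w = None\<close>.\<close>

definition gap :: "nat set \<Rightarrow> nat set \<Rightarrow> (nat \<Rightarrow> nat) \<Rightarrow> nat option \<Rightarrow> nat set" where
  "gap B Q y w = {q \<in> Q. \<forall>r\<in>B. y r < y q \<longleftrightarrow> (\<exists>p. w = Some p \<and> y r \<le> y p)}"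

text \<open>The floor of the gap is the highest point of B below q, if there is one.\<close>

lemma ex_gap:
  assumes "finite B" "q \<in> Q"
  shows "\<exists>w\<in>insert None (Some ` B). q \<in> gap B Q y w"
proof (cases "\<exists>r\<in>B. y r < y q")
  case False
  then show ?thesis using assms by (auto simp: gap_def)
next
  case True
  then obtain p where p: "p \<in> B" "y p < y q" "\<And>r. r \<in> B \<Longrightarrow> y r < y q \<Longrightarrow> y r \<le> y p"
  proof -
    let ?D = "{r \<in> B. y r < y q}"
    have D: "finite (y ` ?D)" "y ` ?D \<noteq> {}" using assms(1) True by auto
    have "Max (y ` ?D) \<in> y ` ?D" by (rule Max_in[OF D])
    then obtain p where "p \<in> ?D" "y p = Max (y ` ?D)" by force
    then show thesis using that[of p] Max_ge[OF D(1)] by simp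
  qed
  then have "q \<in> gap B Q y (Some p)" using assms(2) by (auto simp: gap_def)
  then show ?thesis using p(1) by blast
qed

text \<open>Points of Q in the gap above p go into the gap above \<open>f p\<close>, following the
  embedding of words. \<open>B'\<close> may have extra points, but that gap still lies between
  \<open>f p\<close> and the image of any higher point of B.\<close>

lemma gap_emb:
  fixes y y' :: "nat \<Rightarrow> nat"
  assumes fin: "finite B" "finite Q" "finite Q'"
    and inj: "inj_on y (B \<union> Q)" "inj_on y' (B' \<union> Q')" and disj: "B \<inter> Q = {}" "B' \<inter> Q' = {}"
    and f: "\<And>p. p \<in> B \<Longrightarrow> f p \<in> B'" "\<And>p q. p \<in> B \<Longrightarrow> q \<in> B \<Longrightarrow> y p < y q \<Longrightarrow> y' (f p) < y' (f q)"
    and emb: "\<And>w. w \<in> insert None (Some ` B) \<Longrightarrow>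
      list_emb R (map l (increasing_list y (gap B Q y w)))
        (map l' (increasing_list y' (gap B' Q' y' (map_option f w))))"
  shows "\<exists>h. (\<forall>q\<in>Q. h q \<in> Q' \<and> R (l q) (l' (h q))) \<and>
    (\<forall>p\<in>B \<union> Q. \<forall>q\<in>B \<union> Q. y p < y q \<longrightarrow>
      y' (if p \<in> Q then h p else f p) < y' (if q \<in> Q then h q else f q))"
proof -
  let ?W = "insert None (Some ` B)"
  have "\<exists>h. \<forall>p\<in>gap B Q y w. h p \<in> gap B' Q' y' (map_option f w) \<and> R (l p) (l' (h p)) \<and>
      (\<forall>q\<in>gap B Q y w. y p < y q \<longrightarrow> y' (h p) < y' (h q))" if "w \<in> ?W" for w
  proof (rule increasing_list_emb[OF _ _ _ _ emb[OF that]])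
    show "finite (gap B Q y w)" "finite (gap B' Q' y' (map_option f w))"
      using fin by (simp_all add: gap_def)
    show "inj_on y (gap B Q y w)" "inj_on y' (gap B' Q' y' (map_option f w))"
      using inj by (auto simp: gap_def intro: inj_on_subset)
  qed
  then obtain H where H: "\<And>w p. w \<in> ?W \<Longrightarrow> p \<in> gap B Q y w \<Longrightarrow>
      H w p \<in> gap B' Q' y' (map_option f w) \<and> R (l p) (l' (H w p))"
    "\<And>w p q. w \<in> ?W \<Longrightarrow> p \<in> gap B Q y w \<Longrightarrow> q \<in> gap B Q y w \<Longrightarrow> y p < y q \<Longrightarrow> y' (H w p) < y' (H w q)"
    by metis
  obtain k where k: "\<And>q. q \<in> Q \<Longrightarrow> k q \<in> ?W" "\<And>q. q \<in> Q \<Longrightarrow> q \<in> gap B Q y (k q)"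
  proof -
    have "\<forall>q. \<exists>w. q \<in> Q \<longrightarrow> w \<in> ?W \<and> q \<in> gap B Q y w" using ex_gap[OF fin(1)] by blast
    from choice[OF this] show thesis using that by blast
  qed
  define h where "h q = H (k q) q" for q
  have h: "h q \<in> gap B' Q' y' (map_option f (k q))" "R (l q) (l' (h q))" if "q \<in> Q" for q
    using H(1)[OF k(1)[OF that] k(2)[OF that]] by (simp_all add: h_def)
  have hQ: "h q \<in> Q'" if "q \<in> Q" for q using h(1)[OF that] by (simp add: gap_def)
  have gap_iff: "y r < y q \<longleftrightarrow> (\<exists>p. k q = Some p \<and> y r \<le> y p)" if "q \<in> Q" "r \<in> B" for q r
    using k(2)[OF that(1)] that(2) by (simp add: gap_def)
  have gap_iff': "y' r < y' (h q) \<longleftrightarrow> (\<exists>p. k q = Some p \<and> y' r \<le> y' (f p))" if "q \<in> Q" "r \<in> B'" for q r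
    using h(1)[OF that(1)] that(2) by (auto simp: gap_def)
  have kB: "p \<in> B" if "q \<in> Q" "k q = Some p" for p q using k(1)[OF that(1)] that(2) by auto
  have f_le: "y' (f p) \<le> y' (f q)" if "p \<in> B" "q \<in> B" "y p \<le> y q" for p q
  proof (cases "y p = y q")
    case True
    then have "p = q" using inj(1) that by (simp add: inj_on_def)
    then show ?thesis by simp
  next
    case False
    then show ?thesis using f(2)[OF that(1,2)] that(3) by simp
  qed
  have BQ: "y' (f p) < y' (h q)" if pq: "p \<in> B" "q \<in> Q" "y p < y q" for p q
  proof -
    obtain r where "k q = Some r" "y p \<le> y r" using gap_iff[OF pq(2,1)] pq(3) by blast
    then show ?thesis
      using gap_iff'[OF pq(2) f(1)[OF pq(1)]] f_le[OF pq(1) kB[OF pq(2)]] by blast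
  qed
  have QB: "y' (h p) < y' (f q)" if "p \<in> Q" "q \<in> B" "y p < y q" for p q
  proof -
    have "\<not> y' (f q) \<le> y' (f r)" if r: "k p = Some r" for r
    proof -
      have "y r < y q" using gap_iff[OF \<open>p \<in> Q\<close> \<open>q \<in> B\<close>] \<open>y p < y q\<close> r
        gap_iff[OF \<open>p \<in> Q\<close> kB[OF \<open>p \<in> Q\<close> r]] by auto
      then show ?thesis using f(2)[OF kB[OF \<open>p \<in> Q\<close> r] \<open>q \<in> B\<close>] by simp
    qed
    then have "\<not> y' (f q) < y' (h p)"
      using gap_iff'[OF that(1) f(1)[OF that(2)]] by blast
    moreover have "y' (f q) \<noteq> y' (h p)"
      using inj_on_eq_iff[OF inj(2), of "f q" "h p"] f(1)[OF that(2)] hQ[OF that(1)] disj(2) by auto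
    ultimately show ?thesis by simp
  qed
  have QQ: "y' (h p) < y' (h q)" if pq: "p \<in> Q" "q \<in> Q" "y p < y q" for p q
  proof (cases "k p = k q")
    case True
    then show ?thesis using H(2)[OF k(1)[OF pq(1)] k(2)[OF pq(1)], of q] k(2)[OF pq(2)] pq(3)
      by (simp add: h_def)
  next
    case False
    have le: "\<exists>s. k q = Some s \<and> y r \<le> y s" if "k p = Some r" for r
      using gap_iff[OF pq(1) kB[OF pq(1) that]] gap_iff[OF pq(2) kB[OF pq(1) that]] that pq(3) by auto
    \<comment> \<open>Points of Q in different gaps are separated by a point of B: the floor
      \<open>s\<close> of the gap of q lies above p. The comparison then passes through
      \<open>f s\<close>.\<close>
    then obtain s where s: "k q = Some s" using False by (cases "k p") (auto, metis not_None_eq)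
    have sB: "s \<in> B" using kB[OF pq(2) s] .
    have "\<not> y s < y p"
    proof
      assume "y s < y p"
      then obtain r where r: "k p = Some r" "y s \<le> y r" using gap_iff[OF pq(1) sB] by blast
      then have "y r = y s" using le[OF r(1)] s by simp
      then have "r = s" using inj(1) sB kB[OF pq(1) r(1)] by (simp add: inj_on_def)
      then show False using False s r by simp
    qed
    moreover have "y s \<noteq> y p" using inj_on_eq_iff[OF inj(1), of s p] sB pq(1) disj(1) by auto
    ultimately have "y' (h p) < y' (f s)" using QB[OF pq(1) sB] by simp
    also have "y' (f s) < y' (h q)" using BQ[OF sB pq(2)] gap_iff[OF pq(2) sB] s by simp
    finally show ?thesis .
  qed
  show ?thesis
  proof (intro exI[of _ h] conjI ballI impI)
    fix p q assume "p \<in> B \<union> Q" "q \<in> B \<union> Q" "y p < y q"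
    then show "y' (if p \<in> Q then h p else f p) < y' (if q \<in> Q then h q else f q)"
      using BQ QB QQ f(2) by auto
  qed (use h hQ in auto)
qed

text \<open>A configuration \<open>(P, x, y, i, j, l)\<close> is a labelled gridded point set: the point \<open>p\<close> lies in
  column \<open>i p\<close> and row \<open>j p\<close>. Only the order of points in a common row or column matters.\<close>

type_synonym conf =
  "nat set \<times> (nat \<Rightarrow> nat) \<times> (nat \<Rightarrow> nat) \<times> (nat \<Rightarrow> nat) \<times> (nat \<Rightarrow> nat) \<times> (nat \<Rightarrow> nat)"

fun grid_emb :: "(nat \<Rightarrow> nat \<Rightarrow> bool) \<Rightarrow> conf \<Rightarrow> conf \<Rightarrow> bool" where
  "grid_emb R (P, x, y, i, j, l) (P', x', y', i', j', l') \<longleftrightarrow> (\<exists>f. \<forall>p\<in>P. f p \<in> P' \<and>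
     i' (f p) = i p \<and> j' (f p) = j p \<and> R (l p) (l' (f p)) \<and>
     (\<forall>q\<in>P. (i p = i q \<and> x p < x q \<longrightarrow> x' (f p) < x' (f q)) \<and>
       (j p = j q \<and> y p < y q \<longrightarrow> y' (f p) < y' (f q))))"

text \<open>The condition on the points of a cell is a predicate rather than a class of
  permutations, so that it can be transposed by exchanging x and y.\<close>

type_synonym cell_classes = "cell \<Rightarrow> nat set \<Rightarrow> (nat \<Rightarrow> nat) \<Rightarrow> (nat \<Rightarrow> nat) \<Rightarrow> bool"

definition confs :: "cell set \<Rightarrow> cell_classes \<Rightarrow> conf set" where
  "confs S K = {(P, x, y, i, j, l). finite P \<and> inj_on x P \<and> inj_on y P \<and> (\<forall>p\<in>P. (i p, j p) \<in> S) \<and>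
     (\<forall>c\<in>S. K c {p \<in> P. (i p, j p) = c} x y)}"

definition labelled_wqo :: "(nat set \<Rightarrow> (nat \<Rightarrow> nat) \<Rightarrow> (nat \<Rightarrow> nat) \<Rightarrow> bool) \<Rightarrow> bool" where
  "labelled_wqo C \<longleftrightarrow> (\<forall>R. wqo_on R UNIV \<longrightarrow>
     wqo_on (points_emb R) {(P, x, y, l). finite P \<and> inj_on x P \<and> inj_on y P \<and> C P x y})"

text \<open>The direction is fixed for the cell and not for each point set, because an embedding
  compares two point sets of the same cell.\<close>

definition monotone_points :: "(nat set \<Rightarrow> (nat \<Rightarrow> nat) \<Rightarrow> (nat \<Rightarrow> nat) \<Rightarrow> bool) \<Rightarrow> bool" where
  "monotone_points C \<longleftrightarrow>
     (\<forall>P x y. C P x y \<longrightarrow> inj_on x P \<longrightarrow> inj_on y P \<longrightarrow>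
       (\<forall>p\<in>P. \<forall>q\<in>P. x p < x q \<longrightarrow> y p < y q)) \<or>
     (\<forall>P x y. C P x y \<longrightarrow> inj_on x P \<longrightarrow> inj_on y P \<longrightarrow>
       (\<forall>p\<in>P. \<forall>q\<in>P. x p < x q \<longrightarrow> y q < y p))"

lemma monotone_points_swap:
  assumes "monotone_points C"
  shows "monotone_points (\<lambda>P x y. C P y x)"
proof -
  consider
    (inc) "\<And>P x y p q. C P x y \<Longrightarrow> inj_on x P \<Longrightarrow> inj_on y P \<Longrightarrow> p \<in> P \<Longrightarrow> q \<in> P \<Longrightarrow> x p < x q \<Longrightarrow> y p < y q"
  | (dec) "\<And>P x y p q. C P x y \<Longrightarrow> inj_on x P \<Longrightarrow> inj_on y P \<Longrightarrow> p \<in> P \<Longrightarrow> q \<in> P \<Longrightarrow> x p < x q \<Longrightarrow> y q < y p"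
    using assms unfolding monotone_points_def by blast
  then show ?thesis
  proof cases
    case inc
    have "x p < x q" if "C P x y" "inj_on x P" "inj_on y P" "p \<in> P" "q \<in> P" "y p < y q" for P x y p q
      using inc[OF that(1,2,3,5,4)] that by (metis inj_onD linorder_neqE_nat order_less_asym)
    then show ?thesis unfolding monotone_points_def by blast
  next
    case dec
    have "x q < x p" if "C P x y" "inj_on x P" "inj_on y P" "p \<in> P" "q \<in> P" "y p < y q" for P x y p q
      using dec[OF that(1,2,3,4,5)] that by (metis inj_onD linorder_neqE_nat order_less_asym)
    then show ?thesis unfolding monotone_points_def by blast
  qed
qed

lemma wqo_on_confs_empty: "wqo_on (grid_emb R) (confs {} K)"
  unfolding wqo_on_def
proof (intro allI impI)
  fix s :: "nat \<Rightarrow> conf" assume s: "\<forall>i. s i \<in> confs {} K"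
  have "grid_emb R (s 0) (s 1)"
    using s[rule_format, of 0] by (cases "s 0"; cases "s 1") (auto simp: confs_def)
  then show "\<exists>i j. i < j \<and> grid_emb R (s i) (s j)" by (intro exI[of _ 0] exI[of _ 1]) simp
qed

text \<open>Points of c share no row or column with points of other cells, so an embedding of the
  former and one of the latter combine without further conditions.\<close>

lemma wqo_on_confs_isolated:
  assumes S: "wqo_on (grid_emb R) (confs S K)" and R: "wqo_on R UNIV"
    and c: "\<forall>d\<in>S. fst d \<noteq> fst c \<and> snd d \<noteq> snd c" "labelled_wqo (K c)"
  shows "wqo_on (grid_emb R) (confs (insert c S) K)"
proof -
  let ?C = "{(P, x, y, l :: nat \<Rightarrow> nat). finite P \<and> inj_on x P \<and> inj_on y P \<and> K c P x y}"
  have wC: "wqo_on (points_emb R) ?C" using c(2) R by (simp add: labelled_wqo_def)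
  define split where "split = (\<lambda>(P :: nat set, x :: nat \<Rightarrow> nat, y :: nat \<Rightarrow> nat, i, j, l :: nat \<Rightarrow> nat).
    (({p \<in> P. (i p, j p) \<noteq> c}, x, y, i, j, l), ({p \<in> P. (i p, j p) = c}, x, y, l)))"
  have "c \<notin> S" using c(1) by blast
  show ?thesis
  proof (rule wqo_on_map[OF wqo_on_Times[OF S wC], where f = split])
    fix z assume z: "z \<in> confs (insert c S) K"
    obtain P x y i j l where eq: "z = (P, x, y, i, j, l)" by (cases z)
    have "{p \<in> {p \<in> P. (i p, j p) \<noteq> c}. (i p, j p) = d} = {p \<in> P. (i p, j p) = d}" if "d \<in> S" for d
      using that \<open>c \<notin> S\<close> by auto
    then show "split z \<in> confs S K \<times> ?C"
      using z by (simp add: eq split_def confs_def inj_on_subset subset_eq)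
        (auto intro: inj_on_subset)
  next
    fix z z' assume z: "z \<in> confs (insert c S) K" "z' \<in> confs (insert c S) K"
    obtain P x y i j l where eq: "z = (P, x, y, i, j, l)" by (cases z)
    obtain P' x' y' i' j' l' where eq': "z' = (P', x', y', i', j', l')" by (cases z')
    assume "(\<lambda>(a, b) (a', b'). grid_emb R a a' \<and> points_emb R b b') (split z) (split z')"
    then have e: "grid_emb R ({p \<in> P. (i p, j p) \<noteq> c}, x, y, i, j, l) ({p \<in> P'. (i' p, j' p) \<noteq> c}, x', y', i', j', l')"
      "points_emb R ({p \<in> P. (i p, j p) = c}, x, y, l) ({p \<in> P'. (i' p, j' p) = c}, x', y', l')"
      by (simp_all add: split_def eq eq')
    obtain f where f: "\<And>p. p \<in> P \<Longrightarrow> (i p, j p) \<noteq> c \<Longrightarrow> f p \<in> P' \<and> i' (f p) = i p \<and> j' (f p) = j p \<and> R (l p) (l' (f p))"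
      "\<And>p q. p \<in> P \<Longrightarrow> (i p, j p) \<noteq> c \<Longrightarrow> q \<in> P \<Longrightarrow> (i q, j q) \<noteq> c \<Longrightarrow>
        (i p = i q \<and> x p < x q \<longrightarrow> x' (f p) < x' (f q)) \<and> (j p = j q \<and> y p < y q \<longrightarrow> y' (f p) < y' (f q))"
      using e(1) unfolding grid_emb.simps by blast
    obtain g where g: "\<And>p. p \<in> P \<Longrightarrow> (i p, j p) = c \<Longrightarrow> g p \<in> P' \<and> (i' (g p), j' (g p)) = c \<and> R (l p) (l' (g p))"
      "\<And>p q. p \<in> P \<Longrightarrow> (i p, j p) = c \<Longrightarrow> q \<in> P \<Longrightarrow> (i q, j q) = c \<Longrightarrow>
        (x p < x q \<longrightarrow> x' (g p) < x' (g q)) \<and> (y p < y q \<longrightarrow> y' (g p) < y' (g q))"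
      using e(2) unfolding points_emb.simps by blast
    have cell: "(i p, j p) \<in> insert c S" if "p \<in> P" for p using z(1) that by (simp add: eq confs_def)
    have same: "(i p, j p) = c \<longleftrightarrow> (i q, j q) = c" if "p \<in> P" "q \<in> P" "i p = i q \<or> j p = j q" for p q
      using cell[OF that(1)] cell[OF that(2)] c(1) that(3) by (metis fst_conv insertE snd_conv)
    show "grid_emb R z z'"
      unfolding eq eq' grid_emb.simps
    proof (intro exI[of _ "\<lambda>p. if (i p, j p) = c then g p else f p"] ballI conjI)
      fix p q assume pq: "p \<in> P" "q \<in> P"
      let ?F = "\<lambda>p. if (i p, j p) = c then g p else f p"
      show "i p = i q \<and> x p < x q \<longrightarrow> x' (?F p) < x' (?F q)"
        using same[OF pq] f(2)[OF pq(1) _ pq(2)] g(2)[OF pq(1) _ pq(2)] by auto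
      show "j p = j q \<and> y p < y q \<longrightarrow> y' (?F p) < y' (?F q)"
        using same[OF pq] f(2)[OF pq(1) _ pq(2)] g(2)[OF pq(1) _ pq(2)] by auto
    qed (use f(1) g(1) in auto)
  qed
qed

text \<open>Each point \<open>p\<close> in the row of the new cell is additionally labelled with the word formed by the
  labels of the points of the new cell in the gap above \<open>p\<close>. The heights of these points determine the
  new cell up to isomorphism, as it is monotone and the only cell of its column.\<close>

lemma wqo_on_confs_column:
  assumes S: "\<And>R. wqo_on R UNIV \<Longrightarrow> wqo_on (grid_emb R) (confs S K)" and R: "wqo_on R UNIV"
    and c: "\<forall>d\<in>S. fst d \<noteq> fst c" "monotone_points (K c)"
  shows "wqo_on (grid_emb R) (confs (insert c S) K)"
proof -
  \<comment> \<open>Labels are natural numbers, so words and pairs are coded by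
    \<open>list_encode\<close> and \<open>prod_encode\<close>; \<open>W\<close> and
    \<open>R'\<close> compare what is decoded.\<close>
  define W where "W u v \<longleftrightarrow> list_emb R (list_decode u) (list_decode v)" for u v
  define R' where "R' u v \<longleftrightarrow> R (fst (prod_decode u)) (fst (prod_decode v)) \<and>
    W (snd (prod_decode u)) (snd (prod_decode v))" for u v
  have wW: "wqo_on W UNIV"
    by (rule wqo_on_map[OF Higman[OF R], where f = list_decode]) (auto simp: W_def)
  have "wqo_on R' UNIV"
    by (rule wqo_on_map[OF wqo_on_Times[OF R wW], where f = prod_decode])
      (auto simp: R'_def split: prod.splits)
  note wS = S[OF this]
  define row where "row P i j = {p \<in> P. (i p, j p) \<noteq> c \<and> j p = snd c}" for P and i j :: "nat \<Rightarrow> nat"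
  define cpts where "cpts P i j = {p \<in> P. (i p, j p) = c}" for P and i j :: "nat \<Rightarrow> nat"
  define word where "word P y i j l w = map l (increasing_list y (gap (row P i j) (cpts P i j) y w))"
    for P y i j and l :: "nat \<Rightarrow> nat" and w
  \<comment> \<open>A gap of the row is recorded at the point below it. The lowest gap has no such
    point, so its word forms a separate component.\<close>
  define split where "split = (\<lambda>(P :: nat set, x :: nat \<Rightarrow> nat, y, i, j, l).
    (({p \<in> P. (i p, j p) \<noteq> c}, x, y, i, j,
      \<lambda>p. prod_encode (l p, list_encode (word P y i j l (Some p)))), list_encode (word P y i j l None)))"
  have "c \<notin> S" using c(1) by blast
  show ?thesis
  proof (rule wqo_on_map[OF wqo_on_Times[OF wS wW], where f = split])
    fix z assume z: "z \<in> confs (insert c S) K"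
    obtain P x y i j l where eq: "z = (P, x, y, i, j, l)" by (cases z)
    have "{p \<in> {p \<in> P. (i p, j p) \<noteq> c}. (i p, j p) = d} = {p \<in> P. (i p, j p) = d}" if "d \<in> S" for d
      using that \<open>c \<notin> S\<close> by auto
    then show "split z \<in> confs S K \<times> UNIV"
      using z by (simp add: eq split_def confs_def inj_on_subset subset_eq)
        (auto intro: inj_on_subset)
  next
    fix z z' assume z: "z \<in> confs (insert c S) K" "z' \<in> confs (insert c S) K"
    obtain P x y i j l where eq: "z = (P, x, y, i, j, l)" by (cases z)
    obtain P' x' y' i' j' l' where eq': "z' = (P', x', y', i', j', l')" by (cases z')
    assume "(\<lambda>(a, b) (a', b'). grid_emb R' a a' \<and> W b b') (split z) (split z')"
    then have e: "grid_emb R' (fst (split z)) (fst (split z'))"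
      and e0: "list_emb R (word P y i j l None) (word P' y' i' j' l' None)"
      by (simp_all add: split_def eq eq' W_def)
    obtain f where f: "\<And>p. p \<in> P \<Longrightarrow> (i p, j p) \<noteq> c \<Longrightarrow> f p \<in> P' \<and> i' (f p) = i p \<and> j' (f p) = j p \<and>
        R (l p) (l' (f p)) \<and> list_emb R (word P y i j l (Some p)) (word P' y' i' j' l' (Some (f p)))"
      "\<And>p q. p \<in> P \<Longrightarrow> (i p, j p) \<noteq> c \<Longrightarrow> q \<in> P \<Longrightarrow> (i q, j q) \<noteq> c \<Longrightarrow>
        (i p = i q \<and> x p < x q \<longrightarrow> x' (f p) < x' (f q)) \<and> (j p = j q \<and> y p < y q \<longrightarrow> y' (f p) < y' (f q))"
      using e unfolding eq eq' split_def prod.case fst_conv grid_emb.simps R'_def W_def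
        prod_encode_inverse snd_conv list_encode_inverse by blast
    let ?B = "row P i j" and ?Q = "cpts P i j" and ?B' = "row P' i' j'" and ?Q' = "cpts P' i' j'"
    have zP: "finite P" "inj_on x P" "inj_on y P" "\<And>p. p \<in> P \<Longrightarrow> (i p, j p) \<in> insert c S" "K c ?Q x y"
      using z(1) by (simp_all add: eq confs_def cpts_def)
    have zP': "finite P'" "inj_on x' P'" "inj_on y' P'" "K c ?Q' x' y'"
      using z(2) by (simp_all add: eq' confs_def cpts_def)
    have "\<exists>h. (\<forall>q\<in>?Q. h q \<in> ?Q' \<and> R (l q) (l' (h q))) \<and>
      (\<forall>p\<in>?B \<union> ?Q. \<forall>q\<in>?B \<union> ?Q. y p < y q \<longrightarrow>
        y' (if p \<in> ?Q then h p else f p) < y' (if q \<in> ?Q then h q else f q))"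
    proof (rule gap_emb)
      show "finite ?B" "finite ?Q" "finite ?Q'" using zP zP' by (simp_all add: row_def cpts_def)
      show "inj_on y (?B \<union> ?Q)" by (rule inj_on_subset[OF zP(3)]) (auto simp: row_def cpts_def)
      show "inj_on y' (?B' \<union> ?Q')" by (rule inj_on_subset[OF zP'(3)]) (auto simp: row_def cpts_def)
      show "?B \<inter> ?Q = {}" "?B' \<inter> ?Q' = {}" by (auto simp: row_def cpts_def)
      show "f p \<in> ?B'" if "p \<in> ?B" for p
      proof -
        have p: "p \<in> P" "(i p, j p) \<noteq> c" "j p = snd c" using that unfolding row_def by blast+
        have "(i' (f p), j' (f p)) = (i p, j p)" using f(1)[OF p(1,2)] by simp
        then show ?thesis using f(1)[OF p(1,2)] p unfolding row_def by simp
      qed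
      show "y' (f p) < y' (f q)" if "p \<in> ?B" "q \<in> ?B" "y p < y q" for p q
      proof -
        have "p \<in> P" "(i p, j p) \<noteq> c" "q \<in> P" "(i q, j q) \<noteq> c" "j p = j q"
          using that(1,2) unfolding row_def by auto
        then show ?thesis using f(2)[of p q] that(3) by blast
      qed
      show "list_emb R (map l (increasing_list y (gap ?B ?Q y w)))
        (map l' (increasing_list y' (gap ?B' ?Q' y' (map_option f w))))"
        if "w \<in> insert None (Some ` ?B)" for w
        using that e0 f(1) by (auto simp: word_def row_def)
    qed
    then obtain h where h: "\<And>q. q \<in> ?Q \<Longrightarrow> h q \<in> ?Q' \<and> R (l q) (l' (h q))"
      "\<And>p q. p \<in> ?B \<union> ?Q \<Longrightarrow> q \<in> ?B \<union> ?Q \<Longrightarrow> y p < y q \<Longrightarrow>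
        y' (if p \<in> ?Q then h p else f p) < y' (if q \<in> ?Q then h q else f q)"
      by blast
    \<comment> \<open>\<open>h\<close> is known to preserve the order of heights. Both point sets
      are monotone in the same direction, so it preserves the horizontal order as well.\<close>
    have hx: "x' (h p) < x' (h q)" if pq: "p \<in> ?Q" "q \<in> ?Q" "x p < x q" for p q
    proof -
      have hy: "y' (h p) < y' (h q)" if "p \<in> ?Q" "q \<in> ?Q" "y p < y q" for p q
        using h(2)[of p q] that by simp
      have "p \<noteq> q" using pq by blast
      have hQ': "h p \<in> ?Q'" "h q \<in> ?Q'" using h(1) pq by blast+
      then have "h p \<in> P'" "h q \<in> P'" by (simp_all add: cpts_def)
      have inj: "inj_on x ?Q" "inj_on y ?Q" "inj_on x' ?Q'" "inj_on y' ?Q'"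
        using zP(2,3) zP'(2,3) by (auto simp: cpts_def intro: inj_on_subset)
      from c(2) consider
        "\<And>P x y p q. K c P x y \<Longrightarrow> inj_on x P \<Longrightarrow> inj_on y P \<Longrightarrow> p \<in> P \<Longrightarrow> q \<in> P \<Longrightarrow> x p < x q \<Longrightarrow> y p < y q"
      | "\<And>P x y p q. K c P x y \<Longrightarrow> inj_on x P \<Longrightarrow> inj_on y P \<Longrightarrow> p \<in> P \<Longrightarrow> q \<in> P \<Longrightarrow> x p < x q \<Longrightarrow> y q < y p"
        unfolding monotone_points_def by blast
      then have "h p \<noteq> h q \<and> \<not> x' (h q) < x' (h p)"
      proof cases
        case 1
        have "y' (h p) < y' (h q)" using hy[OF pq(1,2)] 1[OF zP(5) inj(1,2) pq] by blast
        then show ?thesis using 1[OF zP'(4) inj(3,4) hQ'(2,1)] by auto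
      next
        case 2
        have "y' (h q) < y' (h p)" using hy[OF pq(2,1)] 2[OF zP(5) inj(1,2) pq] by blast
        then show ?thesis using 2[OF zP'(4) inj(3,4) hQ'(2,1)] by auto
      qed
      then show ?thesis
        using zP'(2) \<open>h p \<in> P'\<close> \<open>h q \<in> P'\<close> by (metis inj_onD linorder_neqE_nat)
    qed
    let ?F = "\<lambda>p. if p \<in> ?Q then h p else f p"
    \<comment> \<open>c is the only cell of its column, so its points never have to be compared
      horizontally with points of other cells.\<close>
    have Q_iff: "p \<in> ?Q \<longleftrightarrow> i p = fst c" if "p \<in> P" for p
      using zP(4)[OF that] c(1) that by (auto simp: cpts_def)
    have F_props: "?F p \<in> P' \<and> i' (?F p) = i p \<and> j' (?F p) = j p \<and> R (l p) (l' (?F p))" if "p \<in> P" for p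
    proof (cases "p \<in> ?Q")
      case True
      then show ?thesis using h(1)[OF True] by (simp add: cpts_def) (metis prod.inject)
    next
      case False
      then show ?thesis using f(1)[OF that] that by (simp add: cpts_def)
    qed
    show "grid_emb R z z'"
      unfolding eq eq' grid_emb.simps
    proof (intro exI[of _ ?F] ballI conjI)
      fix p q assume pq: "p \<in> P" "q \<in> P"
      show "i p = i q \<and> x p < x q \<longrightarrow> x' (?F p) < x' (?F q)"
      proof (intro impI, elim conjE)
        assume a: "i p = i q" "x p < x q"
        then have iff: "p \<in> ?Q \<longleftrightarrow> q \<in> ?Q" using Q_iff pq by simp
        show "x' (?F p) < x' (?F q)"
        proof (cases "p \<in> ?Q")
          case True
          then show ?thesis using iff hx a by simp
        next
          case False
          then have "(i p, j p) \<noteq> c" "(i q, j q) \<noteq> c" using iff pq by (simp_all add: cpts_def)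
          then show ?thesis using f(2)[OF pq(1) _ pq(2)] a iff False by simp
        qed
      qed
      show "j p = j q \<and> y p < y q \<longrightarrow> y' (?F p) < y' (?F q)"
      proof (intro impI, elim conjE)
        assume a: "j p = j q" "y p < y q"
        show "y' (?F p) < y' (?F q)"
        \<comment> \<open>In the row of c, \<open>gap_emb\<close> has ordered old and new points
          together; the other rows contain no new points.\<close>
        proof (cases "j p = snd c")
          case True
          then have "p \<in> ?B \<union> ?Q" "q \<in> ?B \<union> ?Q" using pq a by (auto simp: row_def cpts_def)
          then show ?thesis using h(2) a by blast
        next
          case False
          then have n: "(i p, j p) \<noteq> c" "(i q, j q) \<noteq> c" using a by auto
          then have "p \<notin> ?Q" "q \<notin> ?Q" by (simp_all add: cpts_def)
          then show ?thesis using f(2)[OF pq(1) n(1) pq(2) n(2)] a by simp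
        qed
      qed
    qed (use F_props in blast)+
  qed
qed

section \<open>Transposition, from columns to rows\<close>

fun swap_conf :: "conf \<Rightarrow> conf" where
  "swap_conf (P, x, y, i, j, l) = (P, y, x, j, i, l)"

lemma wqo_on_confs_swap:
  assumes "wqo_on (grid_emb R) (confs S K)"
  shows "wqo_on (grid_emb R) (confs (prod.swap ` S) (\<lambda>c P x y. K (prod.swap c) P y x))"
proof (rule wqo_on_map[OF assms, where f = swap_conf])
  fix z assume z: "z \<in> confs (prod.swap ` S) (\<lambda>c P x y. K (prod.swap c) P y x)"
  obtain P x y i j l where eq: "z = (P, x, y, i, j, l)" by (cases z)
  have sw: "(a, b) \<in> prod.swap ` S \<longleftrightarrow> (b, a) \<in> S" for a b by (force simp: image_iff)
  have "{p \<in> P. (j p, i p) = c} = {p \<in> P. (i p, j p) = prod.swap c}" for c by (cases c) auto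
  then show "swap_conf z \<in> confs S K"
    using z by (simp add: eq confs_def sw)
next
  fix z z' :: conf
  obtain P x y i j l where eq: "z = (P, x, y, i, j, l)" by (cases z)
  obtain P' x' y' i' j' l' where eq': "z' = (P', x', y', i', j', l')" by (cases z')
  assume "grid_emb R (swap_conf z) (swap_conf z')"
  then obtain f where "\<forall>p\<in>P. f p \<in> P' \<and> j' (f p) = j p \<and> i' (f p) = i p \<and> R (l p) (l' (f p)) \<and>
     (\<forall>q\<in>P. (j p = j q \<and> y p < y q \<longrightarrow> y' (f p) < y' (f q)) \<and>
       (i p = i q \<and> x p < x q \<longrightarrow> x' (f p) < x' (f q)))"
    unfolding eq eq' swap_conf.simps grid_emb.simps by blast
  then show "grid_emb R z z'"
    unfolding eq eq' grid_emb.simps by (intro exI[of _ f]) blast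
qed

lemma wqo_on_confs_row:
  assumes S: "\<And>R. wqo_on R UNIV \<Longrightarrow> wqo_on (grid_emb R) (confs S K)" and R: "wqo_on R UNIV"
    and c: "\<forall>d\<in>S. snd d \<noteq> snd c" "monotone_points (K c)"
  shows "wqo_on (grid_emb R) (confs (insert c S) K)"
proof -
  let ?K = "\<lambda>c P x y. K (prod.swap c) P y x"
  have "wqo_on (grid_emb R) (confs (insert (prod.swap c) (prod.swap ` S)) ?K)"
  proof (rule wqo_on_confs_column[OF wqo_on_confs_swap[OF S] R])
    show "\<forall>d\<in>prod.swap ` S. fst d \<noteq> fst (prod.swap c)" using c(1) by auto
    show "monotone_points (?K (prod.swap c))" using monotone_points_swap[OF c(2)] by simp
  qed
  from wqo_on_confs_swap[OF this] show ?thesis by (simp add: image_image)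
qed

text \<open>R is arbitrary in the induction, since the rules \<open>column\<close> and
  \<open>row\<close> apply the hypothesis to labels enlarged by words.\<close>

theorem wqo_on_confs:
  assumes "buildable N S" "\<And>c. c \<in> S \<Longrightarrow> labelled_wqo (K c)"
    "\<And>c. c \<in> S - N \<Longrightarrow> monotone_points (K c)" "wqo_on R UNIV"
  shows "wqo_on (grid_emb R) (confs S K)"
  using assms
proof (induction arbitrary: R)
  case empty
  show ?case by (rule wqo_on_confs_empty)
next
  case (isolated S c)
  then show ?case by (intro wqo_on_confs_isolated) auto
next
  case (column S c)
  then show ?case by (intro wqo_on_confs_column) auto
next
  case (row S c)
  then show ?case by (intro wqo_on_confs_row) auto
qed

section \<open>Grid classes\<close>

lemma nths_conv_filter: "nths xs A = map ((!) xs) (filter (\<lambda>p. p \<in> A) [0..<length xs])"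
proof (induction xs rule: rev_induct)
  case (snoc x xs)
  have "map ((!) (xs @ [x])) (filter (\<lambda>p. p \<in> A) [0..<length xs]) =
    map ((!) xs) (filter (\<lambda>p. p \<in> A) [0..<length xs])"
    by (rule map_cong) (auto simp: nth_append)
  then show ?case using snoc by (simp add: nths_append)
qed simp

lemma cell_points_conv:
  "cell_points \<pi> v h i j = map ((!) \<pi>) (filter (\<lambda>p. v (i - 1) \<le> p \<and> p < v i \<and>
     h (j - 1) < \<pi> ! p \<and> \<pi> ! p \<le> h j) [0..<length \<pi>])"
  by (simp add: cell_points_def nths_conv_filter filter_map comp_def conj_ac)

lemma has_pattern_nth:
  assumes "order_iso (map ((!) \<pi>) ps) \<sigma>" "sorted_wrt (<) ps"
  shows "has_pattern (set ps) id ((!) \<pi>) \<sigma>"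
proof -
  have len: "length \<sigma> = length ps" using assms(1) by (simp add: order_iso_def)
  have lt: "ps ! a < ps ! b" if "a < b" "b < length ps" for a b
    using sorted_wrt_nth_less[OF assms(2)] that by blast
  have "bij_betw ((!) ps) {..<length \<sigma>} (set ps)"
    using assms(2) len by (intro bij_betw_nth) (auto simp: strict_sorted_iff)
  moreover have "ps ! a < ps ! b \<longleftrightarrow> a < b" if "a < length ps" "b < length ps" for a b
    using lt that by (metis linorder_neqE_nat order_less_asym)
  ultimately show ?thesis
    unfolding has_pattern_def using assms(1) len
    by (intro exI[of _ "(!) ps"]) (auto simp: order_iso_def)
qed

text \<open>A gridding may leave a cell of nonempty class without points, and \<open>confs\<close>
  still asks for a pattern of that cell in the class.\<close>

lemma Nil_in_perm_class:
  assumes "perm_class C" "C \<noteq> {}"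
  shows "[] \<in> C"
proof -
  obtain \<sigma> where "\<sigma> \<in> C" using assms(2) by blast
  moreover have "[] \<in> perms" by (simp add: perms_iff exI[of _ 0])
  moreover have "contained_in [] \<sigma>" by (rule contained_inI) auto
  ultimately show ?thesis using assms(1) by (auto simp: perm_class_def)
qed

lemma labelled_wqo_pattern_in:
  assumes "perm_class C" "finite {\<sigma> \<in> C. simple_perm \<sigma>}"
  shows "labelled_wqo (pattern_in C)"
  using wqo_on_labelled_class[OF assms] by (simp add: labelled_wqo_def labelled_class_def)

text \<open>Two points in the wrong relative order would form an occurrence of the avoided pattern;
  injectivity of y then gives the strict opposite inequality.\<close>

lemma monotone_points_pattern_in:
  assumes "monotone_class C"
  shows "monotone_points (pattern_in C)"
proof -
  have *: "\<exists>\<sigma>\<in>C. \<exists>a b. a < b \<and> b < length \<sigma> \<and> (y p < y q \<longleftrightarrow> \<sigma> ! a < \<sigma> ! b) \<and> (y q < y p \<longleftrightarrow> \<sigma> ! b < \<sigma> ! a)"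
    if P: "pattern_in C P x y" "p \<in> P" "q \<in> P" "x p < x q" for P x y p q
  proof -
    obtain \<sigma> g where \<sigma>: "\<sigma> \<in> C" and g: "bij_betw g {..<length \<sigma>} P"
      "\<And>a b. a < length \<sigma> \<Longrightarrow> b < length \<sigma> \<Longrightarrow> x (g a) < x (g b) \<longleftrightarrow> a < b"
      "\<And>a b. a < length \<sigma> \<Longrightarrow> b < length \<sigma> \<Longrightarrow> y (g a) < y (g b) \<longleftrightarrow> \<sigma> ! a < \<sigma> ! b"
      using P(1) unfolding pattern_in_def has_pattern_def by blast
    obtain a b where "a < length \<sigma>" "b < length \<sigma>" "p = g a" "q = g b"
      using P(2,3) g(1) unfolding bij_betw_def by blast
    then show ?thesis using \<sigma> g(2,3) P(4) by blast
  qed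
  have contained: "contained_in [c, d] \<sigma>"
    if "a < b" "b < length \<sigma>" "\<sigma> ! a < \<sigma> ! b \<longleftrightarrow> c < d" "\<sigma> ! b < \<sigma> ! a \<longleftrightarrow> d < c" for a b c d \<sigma>
    by (rule contained_inI[of _ "\<lambda>k. if k = 0 then a else b"]) (use that in \<open>auto simp: less_Suc_eq\<close>)
  consider "C = Av [2, 1]" | "C = Av [1, 2]" using assms by (auto simp: monotone_class_def)
  then show ?thesis
  proof cases
    case 1
    have "\<not> y q < y p" if P: "pattern_in C P x y" "p \<in> P" "q \<in> P" "x p < x q" for P x y p q
      using *[OF P] contained[of _ _ _ 2 1] unfolding 1 Av_def by fastforce
    then show ?thesis unfolding monotone_points_def by (metis inj_onD less_irrefl linorder_neqE_nat)
  next
    case 2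
    have "\<not> y p < y q" if P: "pattern_in C P x y" "p \<in> P" "q \<in> P" "x p < x q" for P x y p q
      using *[OF P] contained[of _ _ _ 1 2] unfolding 2 Av_def by fastforce
    then show ?thesis unfolding monotone_points_def by (metis inj_onD less_irrefl linorder_neqE_nat)
  qed
qed

text \<open>The index, counted from 1, of the column or row containing the coordinate
  \<open>a\<close>. Taking the least one skips the empty strips between coinciding lines.\<close>

definition slab :: "(nat \<Rightarrow> nat) \<Rightarrow> nat \<Rightarrow> nat" where
  "slab v a = (LEAST k. a \<le> v k)"

lemma slab:
  assumes v: "v 0 = 0" "mono_on {0..m} v" and a: "0 < a" "a \<le> v m"
  shows "slab v a \<in> {1..m}" "v (slab v a - 1) < a" "a \<le> v (slab v a)"
    "k \<in> {1..m} \<Longrightarrow> v (k - 1) < a \<Longrightarrow> a \<le> v k \<Longrightarrow> slab v a = k"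
proof -
  show le: "a \<le> v (slab v a)" unfolding slab_def by (rule LeastI[of _ m]) (rule a)
  have "slab v a \<le> m" unfolding slab_def by (rule Least_le) (rule a)
  moreover have "slab v a \<noteq> 0" using le v(1) a(1) by (metis not_le)
  ultimately show "slab v a \<in> {1..m}" by simp
  then show "v (slab v a - 1) < a"
    using not_less_Least[of "slab v a - 1" "\<lambda>k. a \<le> v k"] by (simp add: slab_def)
  assume k: "k \<in> {1..m}" "v (k - 1) < a" "a \<le> v k"
  have "\<not> l \<le> k - 1" if "a \<le> v l" for l
    using mono_onD[OF v(2), of l "k - 1"] k that by fastforce
  then show "slab v a = k" unfolding slab_def using k by (intro Least_equality) fastforce+
qed

text \<open>A grid line separates the two coordinates. This is what lets \<open>grid_emb\<close>
  ignore the order of points in different columns or rows.\<close>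

lemma slab_less:
  assumes v: "v 0 = 0" "mono_on {0..m} v" and ab: "0 < a" "a \<le> v m" "0 < b" "b \<le> v m"
    and "slab v a < slab v b"
  shows "a < b"
proof -
  have "v (slab v a) \<le> v (slab v b - 1)"
    using slab(1)[OF v ab(1,2)] slab(1)[OF v ab(3,4)] assms(7) by (intro mono_onD[OF v(2)]) auto
  then show ?thesis using slab(3)[OF v ab(1,2)] slab(2)[OF v ab(3,4)] by linarith
qed

text \<open>\<open>Suc p\<close> appears because list indices start at 0, whereas the positions cut
  by the vertical lines start at 1; values start at 1 already. All labels are equal, as
  \<open>Grid\<close> consists of unlabelled permutations.\<close>

definition conf_of :: "nat list \<Rightarrow> (nat \<Rightarrow> nat) \<Rightarrow> (nat \<Rightarrow> nat) \<Rightarrow> conf" where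
  "conf_of \<pi> v h = ({..<length \<pi>}, id, (!) \<pi>, \<lambda>p. slab v (Suc p), \<lambda>p. slab h (\<pi> ! p), \<lambda>_. 0)"

lemma perm_nth_range:
  assumes "\<pi> \<in> perms" "p < length \<pi>"
  shows "0 < \<pi> ! p \<and> \<pi> ! p \<le> length \<pi>"
proof -
  obtain k where k: "distinct \<pi>" "set \<pi> = {1..k}" using assms(1) by (auto simp: perms_iff)
  then have "length \<pi> = k" using distinct_card[of \<pi>] by simp
  then show ?thesis using nth_mem[OF assms(2)] k(2) by auto
qed

lemma conf_of_in_confs:
  assumes M: "gridding_matrix m n M" and \<pi>: "\<pi> \<in> perms" and g: "is_gridding m n M \<pi> v h"
  shows "conf_of \<pi> v h \<in> confs (nonempty_cells m n M) (\<lambda>c. pattern_in (M (fst c) (snd c)))"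
proof -
  have v: "v 0 = 0" "mono_on {0..m} v" "v m = length \<pi>"
    and h: "h 0 = 0" "mono_on {0..n} h" "h n = length \<pi>"
    and cells: "\<And>i j. i \<in> {1..m} \<Longrightarrow> j \<in> {1..n} \<Longrightarrow>
      cell_points \<pi> v h i j = [] \<or> (\<exists>\<sigma>\<in>M i j. order_iso (cell_points \<pi> v h i j) \<sigma>)"
    using g by (auto simp: is_gridding_def)
  define pts where "pts i j = filter (\<lambda>p. v (i - 1) \<le> p \<and> p < v i \<and> h (j - 1) < \<pi> ! p \<and> \<pi> ! p \<le> h j)
    [0..<length \<pi>]" for i j
  have cp: "cell_points \<pi> v h i j = map ((!) \<pi>) (pts i j)" for i j
    by (simp add: cell_points_conv pts_def)
  have vr: "0 < Suc p" "Suc p \<le> v m" and hr: "0 < \<pi> ! p" "\<pi> ! p \<le> h n" if "p < length \<pi>" for p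
    using that perm_nth_range[OF \<pi> that] v h by auto
  have pts: "{p \<in> {..<length \<pi>}. (slab v (Suc p), slab h (\<pi> ! p)) = (i, j)} = set (pts i j)"
    if "i \<in> {1..m}" "j \<in> {1..n}" for i j
  proof (intro equalityI subsetI)
    fix p assume "p \<in> {p \<in> {..<length \<pi>}. (slab v (Suc p), slab h (\<pi> ! p)) = (i, j)}"
    then have p: "p < length \<pi>" "slab v (Suc p) = i" "slab h (\<pi> ! p) = j" by auto
    show "p \<in> set (pts i j)"
      using slab(2,3)[OF v(1,2) vr[OF p(1)]] slab(2,3)[OF h(1,2) hr[OF p(1)]] p by (simp add: pts_def)
  next
    fix p assume "p \<in> set (pts i j)"
    then have p: "p < length \<pi>" "v (i - 1) < Suc p" "Suc p \<le> v i" "h (j - 1) < \<pi> ! p" "\<pi> ! p \<le> h j"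
      by (auto simp: pts_def)
    show "p \<in> {p \<in> {..<length \<pi>}. (slab v (Suc p), slab h (\<pi> ! p)) = (i, j)}"
      using slab(4)[OF v(1,2) vr[OF p(1)] that(1) p(2,3)] slab(4)[OF h(1,2) hr[OF p(1)] that(2) p(4,5)] p(1)
      by simp
  qed
  \<comment> \<open>The points of an occupied cell have a pattern in its class by the definition of
    a gridding, so that class is not empty.\<close>
  have ne: "(slab v (Suc p), slab h (\<pi> ! p)) \<in> nonempty_cells m n M" if p: "p < length \<pi>" for p
  proof -
    have ij: "slab v (Suc p) \<in> {1..m}" "slab h (\<pi> ! p) \<in> {1..n}"
      using slab(1)[OF v(1,2) vr[OF p]] slab(1)[OF h(1,2) hr[OF p]] by auto
    have "p \<in> set (pts (slab v (Suc p)) (slab h (\<pi> ! p)))" using pts[OF ij] p by auto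
    then have "cell_points \<pi> v h (slab v (Suc p)) (slab h (\<pi> ! p)) \<noteq> []" by (auto simp: cp)
    then show ?thesis using cells[OF ij] ij by (auto simp: nonempty_cells_def)
  qed
  have pat: "pattern_in (M i j) (set (pts i j)) id ((!) \<pi>)" if ij: "(i, j) \<in> nonempty_cells m n M" for i j
  proof (cases "pts i j = []")
    case True
    have "[] \<in> M i j" using ij M by (intro Nil_in_perm_class) (auto simp: nonempty_cells_def gridding_matrix_def)
    moreover have "has_pattern {} id ((!) \<pi>) []" by (simp add: has_pattern_def bij_betw_def)
    ultimately show ?thesis using True by (auto simp: pattern_in_def)
  next
    case False
    then obtain \<sigma> where \<sigma>: "\<sigma> \<in> M i j" "order_iso (map ((!) \<pi>) (pts i j)) \<sigma>"
      using cells[of i j] ij by (auto simp: cp nonempty_cells_def)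
    have "sorted_wrt (<) (pts i j)" unfolding pts_def by (intro sorted_wrt_filter) simp
    then show ?thesis using has_pattern_nth[OF \<sigma>(2)] \<sigma>(1) by (auto simp: pattern_in_def)
  qed
  have "inj_on ((!) \<pi>) {..<length \<pi>}"
    using \<pi> by (auto simp: perms_iff intro: inj_on_nth)
  moreover have "pattern_in (M (fst c) (snd c)) {p \<in> {..<length \<pi>}. (slab v (Suc p), slab h (\<pi> ! p)) = c} id ((!) \<pi>)"
    if "c \<in> nonempty_cells m n M" for c
    using pat[of "fst c" "snd c"] pts[of "fst c" "snd c"] that by (auto simp: nonempty_cells_def)
  ultimately show ?thesis using ne by (simp add: conf_of_def confs_def)
qed

text \<open>\<open>f\<close> keeps the column and row of every point. Points in a common slab are
  ordered by the embedding, points in different slabs by \<open>slab_less\<close> on both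
  sides.\<close>

lemma contained_in_if_grid_emb:
  assumes \<pi>: "\<pi> \<in> perms" "is_gridding m n M \<pi> v h" and \<pi>': "\<pi>' \<in> perms" "is_gridding m n M \<pi>' v' h'"
    and emb: "grid_emb R (conf_of \<pi> v h) (conf_of \<pi>' v' h')"
  shows "contained_in \<pi> \<pi>'"
proof -
  obtain f where f: "\<And>p. p < length \<pi> \<Longrightarrow> f p < length \<pi>' \<and> slab v' (Suc (f p)) = slab v (Suc p) \<and>
      slab h' (\<pi>' ! f p) = slab h (\<pi> ! p)"
    "\<And>p q. p < length \<pi> \<Longrightarrow> q < length \<pi> \<Longrightarrow>
      (slab v (Suc p) = slab v (Suc q) \<and> p < q \<longrightarrow> f p < f q) \<and>
      (slab h (\<pi> ! p) = slab h (\<pi> ! q) \<and> \<pi> ! p < \<pi> ! q \<longrightarrow> \<pi>' ! f p < \<pi>' ! f q)"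
    using emb unfolding conf_of_def grid_emb.simps by auto
  have v: "v 0 = 0" "mono_on {0..m} v" "v m = length \<pi>"
    and h: "h 0 = 0" "mono_on {0..n} h" "h n = length \<pi>"
    using \<pi>(2) by (auto simp: is_gridding_def)
  have v': "v' 0 = 0" "mono_on {0..m} v'" "v' m = length \<pi>'"
    and h': "h' 0 = 0" "mono_on {0..n} h'" "h' n = length \<pi>'"
    using \<pi>'(2) by (auto simp: is_gridding_def)
  have f_less: "f p < f q" if pq: "p < length \<pi>" "q < length \<pi>" "p < q" for p q
  proof -
    have "\<not> slab v (Suc q) < slab v (Suc p)"
      using slab_less[OF v(1,2), of "Suc q" "Suc p"] pq v(3) by auto
    then consider "slab v (Suc p) = slab v (Suc q)" | "slab v (Suc p) < slab v (Suc q)" by linarith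
    then show ?thesis
    proof cases
      case 2
      then show ?thesis
        using slab_less[OF v'(1,2), of "Suc (f p)" "Suc (f q)"] f(1)[OF pq(1)] f(1)[OF pq(2)] v'(3) by auto
    qed (use f(2)[OF pq(1,2)] pq(3) in blast)
  qed
  have y_less: "\<pi>' ! f p < \<pi>' ! f q" if pq: "p < length \<pi>" "q < length \<pi>" "\<pi> ! p < \<pi> ! q" for p q
  proof -
    have "\<not> slab h (\<pi> ! q) < slab h (\<pi> ! p)"
      using slab_less[OF h(1,2), of "\<pi> ! q" "\<pi> ! p"] perm_nth_range[OF \<pi>(1)] pq h(3) by auto
    then consider "slab h (\<pi> ! p) = slab h (\<pi> ! q)" | "slab h (\<pi> ! p) < slab h (\<pi> ! q)" by linarith
    then show ?thesis
    proof cases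
      case 2
      then show ?thesis
        using slab_less[OF h'(1,2), of "\<pi>' ! f p" "\<pi>' ! f q"] f(1)[OF pq(1)] f(1)[OF pq(2)]
          perm_nth_range[OF \<pi>'(1)] h'(3) by auto
    qed (use f(2)[OF pq(1,2)] pq(3) in blast)
  qed
  show ?thesis
  proof (rule contained_inI[of _ f])
    show "\<pi>' ! f p < \<pi>' ! f q \<longleftrightarrow> \<pi> ! p < \<pi> ! q" if pq: "p < length \<pi>" "q < length \<pi>" for p q
    proof -
      have "p = q \<or> \<pi> ! p \<noteq> \<pi> ! q" using pq \<pi>(1) by (auto simp: perms_iff nth_eq_iff_index_eq)
      then show ?thesis using y_less[OF pq] y_less[OF pq(2,1)] by (metis linorder_neqE_nat order_less_asym)
    qed
  qed (use f(1) f_less in auto)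
qed

lemma partially_well_ordered_if_wqo:
  assumes "wqo_on contained_in C"
  shows "partially_well_ordered C"
  unfolding partially_well_ordered_def
proof
  assume "\<exists>A\<subseteq>C. infinite A \<and> antichain A"
  then obtain A where A: "A \<subseteq> C" "infinite A" "antichain A" by blast
  obtain s :: "nat \<Rightarrow> nat list" where s: "inj s" "range s \<subseteq> A"
    using infinite_countable_subset[OF A(2)] by blast
  have "s i \<in> C" for i using s(2) A(1) by blast
  then obtain i j where ij: "i < j" "contained_in (s i) (s j)" using wqo_onD[OF assms] by blast
  then have "s i \<noteq> s j" using s(1) by (auto simp: inj_def)
  moreover have "s i \<in> A" "s j \<in> A" using s(2) by auto
  ultimately show False using A(3) ij(2) by (auto simp: antichain_def)
qed

theorem theorem8:
  fixes m n :: nat and M :: "nat \<Rightarrow> nat \<Rightarrow> nat list set"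
  assumes "gridding_matrix m n M"
    and "\<And>i j. (i, j) \<in> nonempty_cells m n M \<Longrightarrow> finite {\<sigma> \<in> M i j. simple_perm \<sigma>}"
    and "undirected_forest (grid_graph m n M)"
    and "\<And>K. K \<in> components_verts (grid_graph m n M) \<Longrightarrow>
           card {(i, j) \<in> K. \<not> monotone_class (M i j)} \<le> 1"
  shows "partially_well_ordered (Grid m n M)"
proof -
  let ?V = "nonempty_cells m n M"
  define N where "N = {c \<in> ?V. \<not> monotone_class (M (fst c) (snd c))}"
  define K where "K c = pattern_in (M (fst c) (snd c))" for c :: cell
  have cls: "perm_class (M (fst c) (snd c))" if "c \<in> ?V" for c
    using assms(1) that by (auto simp: nonempty_cells_def gridding_matrix_def)
  have card: "card {c \<in> L. \<not> monotone_class (M (fst c) (snd c))} \<le> 1"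
    if "L \<in> components_verts (grid_graph m n M)" for L
    using assms(4)[OF that] by (simp add: case_prod_unfold)
  have "buildable N ?V"
  proof (rule buildable_forest)
    have "?V \<subseteq> {1..m} \<times> {1..n}" by (auto simp: nonempty_cells_def)
    then show "finite ?V" by (rule finite_subset) simp
    show "\<not> has_cycle (line_adj ?V)" using assms(3) by (rule no_cycle_grid_graph)
    show "c = d" if "c \<in> N" "d \<in> N" "(line_adj ?V)\<^sup>*\<^sup>* c d" for c d
      by (rule line_adj_component[OF card _ _ _ that(3)]) (use that in \<open>auto simp: N_def\<close>)
  qed
  then have wqo: "wqo_on (grid_emb (\<le>)) (confs ?V K)"
  proof (rule wqo_on_confs)
    show "labelled_wqo (K c)" if "c \<in> ?V" for c
      unfolding K_def using assms(2)[of "fst c" "snd c"] that cls[OF that]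
      by (intro labelled_wqo_pattern_in) simp_all
    show "monotone_points (K c)" if "c \<in> ?V - N" for c
      unfolding K_def using that by (intro monotone_points_pattern_in) (simp add: N_def)
  qed (rule wqo_on_le_nat)
  \<comment> \<open>A permutation can have several griddings; fixing one for each makes the passage
    to configurations a map, as \<open>wqo_on_map\<close> requires.\<close>
  have "\<forall>\<pi>. \<exists>v h. \<pi> \<in> Grid m n M \<longrightarrow> \<pi> \<in> perms \<and> is_gridding m n M \<pi> v h"
    by (auto simp: Grid_def)
  then obtain v h where vh: "\<And>\<pi>. \<pi> \<in> Grid m n M \<Longrightarrow> \<pi> \<in> perms \<and> is_gridding m n M \<pi> (v \<pi>) (h \<pi>)"
    by metis
  have "wqo_on contained_in (Grid m n M)"
  proof (rule wqo_on_map[OF wqo, where f = "\<lambda>\<pi>. conf_of \<pi> (v \<pi>) (h \<pi>)"])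
    show "conf_of \<pi> (v \<pi>) (h \<pi>) \<in> confs ?V K" if "\<pi> \<in> Grid m n M" for \<pi>
      using conf_of_in_confs[OF assms(1)] vh[OF that] unfolding K_def by blast
    show "contained_in \<pi> \<pi>'"
      if "\<pi> \<in> Grid m n M" "\<pi>' \<in> Grid m n M"
        "grid_emb (\<le>) (conf_of \<pi> (v \<pi>) (h \<pi>)) (conf_of \<pi>' (v \<pi>') (h \<pi>'))" for \<pi> \<pi>'
      using contained_in_if_grid_emb[OF _ _ _ _ that(3)] vh[OF that(1)] vh[OF that(2)] by blast
  qed
  then show ?thesis by (rule partially_well_ordered_if_wqo)
qed

end
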